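(* Let $c_1=\frac{40001}{80000}$. For every integer $n\ge 400001$, every orthodox cover $C$ of the $n\times n$ queen's graph $Q_n$ satisfies $$|C|>c_1 n-2 .$$
   Context: The queen's graph $Q_n$ has as vertices the squares $(x,y)\in\{0,\ldots,n-1\}^2$ of the $n\times n$ chessboard ($x$ is the column, $y$ the row); two distinct squares are adjacent if they share a row ($y$ equal), a column ($x$ equal), or a diagonal ($y-x$ equal or $x+y$ equal). Elements of a set $C$ of squares are called queens. $C$ is a dominating set if every square belongs to $C$ or is adjacent to a square of $C$. A row or column is occupied if it contains a queen of $C$. A dominating set $C$ is an orthodox cover if there exist $p,q\in\{0,1\}$ (possibly different) such that every column of parity $p$ (index $x\equiv p \bmod 2$) and every row of parity $q$ (index $y\equiv q\bmod 2$) is occupied. Queens may attack one another and may lie on the board boundary; $n$ may be odd or even. *)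

theory Defs
  imports "HOL-Analysis.Analysis" "Graph_Theory.Pair_Digraph"
begin

text \<open>Squares are pairs \<open>(x, y)\<close> of a column \<open>x\<close> and a row \<open>y\<close>. The coordinates are
  integers rather than natural numbers so that the difference \<open>y - x\<close> is not truncated.\<close>

type_synonym square = "int \<times> int"

definition board :: "nat \<Rightarrow> square set" where
  "board n = {0..<int n} \<times> {0..<int n}"

definition queen_attacks :: "square \<Rightarrow> square \<Rightarrow> bool" where
  "queen_attacks u v \<longleftrightarrow> u \<noteq> v \<and>
     (snd u = snd v \<or> fst u = fst v \<or> snd u - fst u = snd v - fst v \<or> fst u + snd u = fst v + snd v)"

text \<open>As usual for \<^locale>\<open>pair_graph\<close>, an undirected edge is represented by its two opposite arcs.\<close>

definition queens_graph :: "nat \<Rightarrow> square pair_pre_digraph" where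
  "queens_graph n = \<lparr> pverts = board n,
     parcs = {(u, v). u \<in> board n \<and> v \<in> board n \<and> queen_attacks u v} \<rparr>"

lemma pair_graph_queens_graph: "pair_graph (queens_graph n)"
proof
  have "finite (board n \<times> board n)"
    by (simp add: board_def)
  then show "finite (parcs (queens_graph n))"
    by (rule rev_finite_subset) (auto simp: queens_graph_def)
  show "symmetric (with_proj (queens_graph n))"
    by (auto simp: symmetric_def sym_def arcs_ends_def arc_to_ends_def queens_graph_def
        queen_attacks_def)
qed (auto simp: queens_graph_def board_def queen_attacks_def)

definition dominating_set :: "'a pair_pre_digraph \<Rightarrow> 'a set \<Rightarrow> bool" where
  "dominating_set G C \<longleftrightarrow> C \<subseteq> pverts G \<and>
     (\<forall>v\<in>pverts G. v \<in> C \<or> (\<exists>u\<in>C. (u, v) \<in> parcs G))"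

definition column_occupied :: "square set \<Rightarrow> int \<Rightarrow> bool" where
  "column_occupied C x \<longleftrightarrow> (\<exists>y. (x, y) \<in> C)"

definition row_occupied :: "square set \<Rightarrow> int \<Rightarrow> bool" where
  "row_occupied C y \<longleftrightarrow> (\<exists>x. (x, y) \<in> C)"

definition orthodox_cover :: "nat \<Rightarrow> square set \<Rightarrow> bool" where
  "orthodox_cover n C \<longleftrightarrow> dominating_set (queens_graph n) C \<and>
     (\<exists>p\<in>{0, 1}. \<exists>q\<in>{0, 1}.
        (\<forall>x\<in>{0..<int n}. x mod 2 = p \<longrightarrow> column_occupied C x) \<and>
        (\<forall>y\<in>{0..<int n}. y mod 2 = q \<longrightarrow> row_occupied C y))"

end

theory Submission
  imports Defs
begin

text \<open>
  Suppose an orthodox cover \<open>C\<close> has only about \<open>n / 2\<close> queens. The columns of parity \<open>p\<close> and the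
  rows of parity \<open>q\<close> already need that many queens, so few other columns and rows are occupied. A
  square whose column and row are free has to be covered along a diagonal. The squares with both
  parities wrong lie on difference diagonals of two residue classes modulo 4. If \<open>e\<close> is the distance
  from the centre to the nearest free difference diagonal in one of these classes, then the squares
  on that diagonal force almost all sum diagonals within distance \<open>n - e\<close> of the centre, in one
  class modulo 4, to be occupied (\<open>missing_sums_of_free_diff\<close>, \<open>ex_occupied_radius\<close>). So two
  numbers \<open>e\<close> and \<open>e'\<close> describe a set of diagonals that must be occupied besides the rows and columns.

  The bound on \<open>card C\<close> is linear programming duality: put nonnegative weights on the lines such that
  no queen collects more than 1; then \<open>card C\<close> is at least the total weight of the lines that must be
  occupied (\<open>card_ge_weight_integrals\<close>). Up to a bounded error and the few missing sum diagonals this total is \<open>n / 2\<close> times a sum of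
  integrals that depends on \<open>t = e / n\<close> and \<open>t' = 1 - e' / n\<close>, and the claim follows once some weight
  system makes that sum larger than \<open>1 + 3 / 10000\<close>.

  For a queen at \<open>(x, y)\<close>, measured from the centre, the squares of its two diagonal numbers add up to
  a multiple of \<open>x\<^sup>2 + y\<^sup>2\<close>. This identity gives two quadratic weight systems (\<open>outer_weights\<close>,
  \<open>inner_weights\<close>), which succeed unless \<open>t (1 - t) + t' (1 - t')\<close> is nearly \<open>1 / 3\<close>. Counting
  diagonals shows that \<open>t\<close> and \<open>t'\<close> nearly agree (\<open>radii_balanced\<close>), so in the remaining case, for
  \<open>e' \<le> e\<close>, both are close to \<open>(3 + sqrt 3) / 6\<close>, where the quadratic weights are exactly balanced. For this
  case there is a third, piecewise linear weight system, a numerical solution of the dual linear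
  program (\<open>table_weights\<close>); its total exceeds \<open>1 + 35 / 100000\<close>.
\<close>

section \<open>Sampling a function on a residue class\<close>

text \<open>With lines numbered from the centre of the board, the columns of one parity, the rows of one
  parity and the diagonals of one class all have this form.\<close>

definition residue_window :: "int \<Rightarrow> int \<Rightarrow> int set" where
  "residue_window c a = {k. k mod 4 = c mod 4 \<and> \<bar>k\<bar> \<le> a}"

lemma finite_residue_window [simp]: "finite (residue_window c a)"
  by (rule finite_subset[of _ "{-a..a}"]) (auto simp: residue_window_def)

text \<open>Each block from \<open>4 * j\<close> to \<open>4 * j + 4\<close> is sampled once, at \<open>4 * j + r\<close>. After division by \<open>n\<close> it has
  length \<open>4 / n\<close>, so the function stays within \<open>4 * L / n\<close> of its sample.\<close>

lemma sum_blocks_ge_integral: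
  fixes g :: "real \<Rightarrow> real"
  assumes n: "n > 0" and r: "0 \<le> r" "r \<le> 4" and L: "L-lipschitz_on {0..R} g"
    and R: "4 * real J / n \<le> R"
  shows "n / 4 * integral {0..4 * real J / n} g - 4 * L / n * real J
           \<le> (\<Sum>j<J. g ((4 * real j + r) / n))"
  using R
proof (induction J)
  case (Suc J)
  let ?a = "4 * real J / n" and ?b = "4 * real (Suc J) / n" and ?z = "(4 * real J + r) / n"
  have le: "0 \<le> ?a" "?a \<le> ?z" "?z \<le> ?b" "?a \<le> ?b" "?b \<le> R"
    using n r Suc.prems by (auto simp: field_simps)
  have L0: "0 \<le> L" using L by (rule lipschitz_on_nonneg)
  have cont: "continuous_on {0..R} g"
    using L by (rule lipschitz_on_continuous_on)
  have int0: "g integrable_on {0..?b}"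
    by (rule integrable_continuous_real, rule continuous_on_subset[OF cont]) (use le in auto)
  have int: "g integrable_on {?a..?b}"
    by (rule integrable_continuous_real, rule continuous_on_subset[OF cont]) (use le in auto)
  have "integral {?a..?b} g \<le> integral {?a..?b} (\<lambda>_. g ?z + L * (4 / n))"
  proof (rule integral_le[OF int])
    fix x assume x: "x \<in> {?a..?b}"
    have "\<bar>x - ?z\<bar> \<le> ?b - ?a" using x le by auto
    also have "?b - ?a = 4 / n" using n by (simp add: field_simps)
    finally have "L * \<bar>x - ?z\<bar> \<le> L * (4 / n)" using L0 by (rule mult_left_mono)
    moreover have "\<bar>g x - g ?z\<bar> \<le> L * \<bar>x - ?z\<bar>"
      using lipschitz_onD[OF L, of x ?z] x le by (auto simp: dist_real_def)
    ultimately show "g x \<le> g ?z + L * (4 / n)" by linarith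
  qed auto
  also have "\<dots> = (g ?z + L * (4 / n)) * (4 / n)"
    using n le by (simp add: field_simps)
  finally have "n / 4 * integral {?a..?b} g \<le> n / 4 * ((g ?z + L * (4 / n)) * (4 / n))"
    using n by (intro mult_left_mono) auto
  also have "\<dots> = g ?z + 4 * L / n" using n by (simp add: field_simps)
  finally have step: "n / 4 * integral {?a..?b} g \<le> g ?z + 4 * L / n" .
  have split: "integral {0..?b} g = integral {0..?a} g + integral {?a..?b} g"
    using le by (intro Henstock_Kurzweil_Integration.integral_combine[symmetric] int0) auto
  have IH: "n / 4 * integral {0..?a} g - 4 * L / n * real J
      \<le> (\<Sum>j<J. g ((4 * real j + r) / n))"
    using le by (intro Suc.IH) linarith
  have "4 * L / n * real (Suc J) = 4 * L / n * real J + 4 * L / n"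
    by (simp add: distrib_left)
  then show ?case using IH step unfolding split distrib_left sum.lessThan_Suc by linarith
qed auto

text \<open>The class is sampled on both sides of 0: the members on the right are \<open>4 * j + r\<close>, those on the left
  have absolute value \<open>4 * j + (4 - r)\<close>. Each side loses \<open>L\<close> to the sampling and at most \<open>5 / 4 * B\<close> on
  the part of \<open>{0..T}\<close> beyond the last complete block.\<close>

lemma sum_residue_window_ge_integral:
  fixes g :: "real \<Rightarrow> real"
  assumes n: "n > 0" and T: "0 \<le> T" "T \<le> 1" "n * T \<le> a + 1"
    and L: "L-lipschitz_on {0..T} g" and B: "\<And>z. z \<in> {0..T} \<Longrightarrow> g z \<le> B"
    and B0: "0 \<le> B"
    and pos: "\<And>k. k \<in> residue_window c a \<Longrightarrow> 0 \<le> g (\<bar>k\<bar> / n)"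
  shows "n / 2 * integral {0..T} g - 2 * L - 5 / 2 * B
           \<le> (\<Sum>k\<in>residue_window c a. g (\<bar>real_of_int k\<bar> / n))"
proof -
  define J where "J = nat \<lfloor>(n * T - 1) / 4\<rfloor>"
  define r where "r = c mod 4"
  have r: "0 \<le> r" "r < 4" by (auto simp: r_def)
  have L0: "0 \<le> L" using L by (rule lipschitz_on_nonneg)
  have nT: "0 \<le> n * T" using n T by simp
  have Jge: "n * T - 5 \<le> 4 * real J" 
  proof -
    have "(n * T - 1) / 4 < real_of_int (int J + 1)" unfolding J_def by linarith
    then show ?thesis by simp
  qed
  have Jle: "4 * real J \<le> n * T - 1 \<or> J = 0"
  proof (cases "\<lfloor>(n * T - 1) / 4\<rfloor> \<le> 0")
    case False
    then have "real J = of_int \<lfloor>(n * T - 1) / 4\<rfloor>" by (simp add: J_def)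
    then have "real J \<le> (n * T - 1) / 4" by (simp only: of_int_floor_le)
    then show ?thesis by simp
  qed (simp add: J_def)
  have JT: "4 * real J / n \<le> T" using Jle n T nT by (auto simp: field_simps)
  have "real_of_int a \<ge> 4 * real J" if "J \<noteq> 0" using that Jle T by linarith
  then have Ja: "4 * int J \<le> a" if "J \<noteq> 0" using that by linarith
  have cont: "continuous_on {0..T} g"
    using L by (rule lipschitz_on_continuous_on)
  have split: "integral {0..T} g = integral {0..4 * real J / n} g + integral {4 * real J / n..T} g"
    using JT n by (intro Henstock_Kurzweil_Integration.integral_combine[symmetric]
        integrable_continuous_real cont) auto
  have J0: "0 \<le> 4 * real J / n" using n by simp
  have "integral {4 * real J / n..T} g \<le> integral {4 * real J / n..T} (\<lambda>_. B)"
    by (rule integral_le, rule integrable_continuous_real, rule continuous_on_subset[OF cont])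
      (use J0 in \<open>auto intro!: B elim: order_trans[OF J0]\<close>)
  also have "\<dots> = B * (T - 4 * real J / n)" using JT by simp
  also have "\<dots> \<le> B * (5 / n)"
  proof (rule mult_left_mono[OF _ B0])
    have "T \<le> (5 + 4 * real J) / n" using Jge n by (simp add: pos_le_divide_eq mult.commute)
    then show "T - 4 * real J / n \<le> 5 / n" by (simp add: add_divide_distrib)
  qed
  finally have "n / 2 * integral {4 * real J / n..T} g \<le> n / 2 * (B * (5 / n))"
    using n by (intro mult_left_mono) auto
  then have tail: "n / 2 * integral {4 * real J / n..T} g \<le> 5 / 2 * B" using n by simp
  have err: "4 * L / n * real J \<le> L"
  proof -
    have "L * (4 * real J / n) \<le> L * 1" using JT T L0 by (intro mult_left_mono) auto
    then show ?thesis by (simp add: field_simps)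
  qed
  have half: "n / 4 * integral {0..4 * real J / n} g - L \<le> (\<Sum>j<J. g ((4 * real j + s) / n))"
    if "0 \<le> s" "s \<le> 4" for s
    using sum_blocks_ge_integral[OF n that L JT] err by linarith
  let ?A = "(\<lambda>j. 4 * int j + r) ` {..<J}" and ?B = "(\<lambda>j. - (4 * int j + (4 - r))) ` {..<J}"
  \<comment> \<open>The bound \<open>4 * J \<le> n * T - 1\<close> in the choice of \<open>J\<close> leaves room for \<open>4 * J\<close>, the largest absolute value that can occur in \<open>?B\<close>.\<close>
  have sub: "?A \<union> ?B \<subseteq> residue_window c a"
  proof
    fix k assume k: "k \<in> ?A \<union> ?B"
    then obtain j where j: "j < J" and kj: "k = 4 * int j + r \<or> k = - (4 * int j + (4 - r))" by auto
    have Jn: "J \<noteq> 0" "int j \<le> int J - 1" using j by auto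
    have "k mod 4 = c mod 4"
      using kj unfolding r_def by presburger
    moreover have "\<bar>k\<bar> \<le> a" using kj Ja[OF Jn(1)] Jn r by linarith
    ultimately show "k \<in> residue_window c a" by (simp add: residue_window_def)
  qed
  have disj: "?A \<inter> ?B = {}" using r by auto
  have A: "(\<Sum>k\<in>?A. g (\<bar>real_of_int k\<bar> / n)) = (\<Sum>j<J. g ((4 * real j + r) / n))"
    using r by (subst sum.reindex) (auto simp: inj_on_def intro!: sum.cong)
  have eqB: "\<bar>real_of_int (- (4 * int j + (4 - r)))\<bar> = 4 * real j + real_of_int (4 - r)" for j
    using r by simp
  have B: "(\<Sum>k\<in>?B. g (\<bar>real_of_int k\<bar> / n)) = (\<Sum>j<J. g ((4 * real j + real_of_int (4 - r)) / n))"
    by (subst sum.reindex) (simp_all only: o_def eqB, simp add: inj_on_def)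
  have "(\<Sum>j<J. g ((4 * real j + r) / n)) + (\<Sum>j<J. g ((4 * real j + real_of_int (4 - r)) / n))
     = (\<Sum>k\<in>?A \<union> ?B. g (\<bar>real_of_int k\<bar> / n))"
    unfolding A[symmetric] B[symmetric] by (rule sum.union_disjoint[symmetric]) (use disj in auto)
  also have "\<dots> \<le> (\<Sum>k\<in>residue_window c a. g (\<bar>real_of_int k\<bar> / n))"
    using sub pos by (intro sum_mono2) auto
  finally show ?thesis
    using half[of r] half[of "real_of_int (4 - r)"] r tail unfolding split
    by (simp add: algebra_simps)
qed

section \<open>Diagonals forced by an orthodox cover\<close>

text \<open>All line numbers are measured from the centre of the board. Those of columns and rows are
  doubled, which keeps them integral and turns a parity into a class modulo 4.\<close>

definition col_no :: "nat \<Rightarrow> square \<Rightarrow> int" where "col_no n u = 2 * fst u - (int n - 1)"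
definition row_no :: "nat \<Rightarrow> square \<Rightarrow> int" where "row_no n u = 2 * snd u - (int n - 1)"
definition diff_no :: "square \<Rightarrow> int" where "diff_no u = snd u - fst u"
definition sum_no :: "nat \<Rightarrow> square \<Rightarrow> int" where "sum_no n u = fst u + snd u - (int n - 1)"

lemma row_minus_col: "row_no n u - col_no n u = 2 * diff_no u"
  and row_plus_col: "row_no n u + col_no n u = 2 * sum_no n u"
  by (auto simp: row_no_def col_no_def diff_no_def sum_no_def)

lemma board_lines_bounded:
  assumes "u \<in> board n"
  shows "\<bar>col_no n u\<bar> \<le> int n - 1" "\<bar>row_no n u\<bar> \<le> int n - 1"
    "\<bar>diff_no u\<bar> + \<bar>sum_no n u\<bar> \<le> int n - 1"
  using assms by (auto simp: board_def col_no_def row_no_def diff_no_def sum_no_def)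

lemma card_parity_class:
  assumes "p \<in> {0, 1::int}"
  shows "int n - 1 \<le> 2 * int (card {x \<in> {0..<int n}. x mod 2 = p})"
proof -
  let ?A = "{x \<in> {0..<int n}. x mod 2 = p}"
  have fin: "finite ?A" by (rule finite_subset[of _ "{0..<int n}"]) auto
  have "(\<lambda>i. 2 * int i + p) ` {..<n div 2} \<subseteq> ?A"
    using assms by auto
  then have "card ((\<lambda>i. 2 * int i + p) ` {..<n div 2}) \<le> card ?A"
    by (intro card_mono fin)
  moreover have "card ((\<lambda>i. 2 * int i + p) ` {..<n div 2}) = n div 2"
    by (subst card_image) (auto simp: inj_on_def)
  ultimately show ?thesis by linarith
qed

text \<open>Each line of \<open>A\<close> contains a queen, so its weight is collected at least once.\<close>

lemma sum_lines_le_sum_queens: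
  fixes \<phi> :: "'a \<Rightarrow> int" and g :: "int \<Rightarrow> real"
  assumes "finite C" "A \<subseteq> \<phi> ` C" "\<And>k. k \<in> A \<Longrightarrow> k mod 4 = c mod 4"
    and "\<And>u. u \<in> C \<Longrightarrow> 0 \<le> g (\<phi> u)"
  shows "sum g A \<le> (\<Sum>u\<in>C. if \<phi> u mod 4 = c mod 4 then g (\<phi> u) else 0)"
proof -
  let ?g = "\<lambda>k. if k mod 4 = c mod 4 then g k else 0"
  have "sum g A = sum ?g A"
    using assms(3) by (intro sum.cong) auto
  also have "\<dots> \<le> sum ?g (\<phi> ` C)"
    using assms by (intro sum_mono2) auto
  also have "\<dots> \<le> (\<Sum>u\<in>C. ?g (\<phi> u))"
    using sum_image_le[of C ?g \<phi>] assms by (auto simp: o_def)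
  finally show ?thesis .
qed

lemma no_missing:
  assumes "A \<subseteq> \<phi> ` C"
  shows "card {k \<in> A. k \<notin> \<phi> ` C} \<le> 0"
proof -
  have "{k \<in> A. k \<notin> \<phi> ` C} = {}" using assms by blast
  then show ?thesis by (simp only: card.empty le0)
qed

text \<open>An orthodox cover together with a choice of its two parities.\<close>

locale parity_cover =
  fixes n :: nat and C :: "square set" and p q :: int
  assumes n_pos: "0 < n"
    and dominating: "dominating_set (queens_graph n) C"
    and p: "p \<in> {0, 1}" and q: "q \<in> {0, 1}"
    and columns: "\<And>x. x \<in> {0..<int n} \<Longrightarrow> x mod 2 = p \<Longrightarrow> column_occupied C x"
    and rows: "\<And>y. y \<in> {0..<int n} \<Longrightarrow> y mod 2 = q \<Longrightarrow> row_occupied C y"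
begin

lemma C_board: "C \<subseteq> board n"
  using dominating by (auto simp: dominating_set_def queens_graph_def)

lemma finite_C: "finite C"
  using C_board by (rule finite_subset) (simp add: board_def)

lemma dominated: "v \<in> board n \<Longrightarrow> v \<in> C \<or> (\<exists>u\<in>C. queen_attacks u v)"
  using dominating by (auto simp: dominating_set_def queens_graph_def)

text \<open>The occupied columns and rows of the other parity. A cover with about \<open>n / 2\<close> queens has few
  of them.\<close>

definition extra :: nat where
  "extra = card {x \<in> fst ` C. x mod 2 \<noteq> p} + card {y \<in> snd ` C. y mod 2 \<noteq> q}"

lemma extra_le: "real extra \<le> 2 * real (card C) - real n + 1"
proof -
  have *: "int (card {x \<in> f ` C. x mod 2 \<noteq> r}) + int (card {x \<in> {0..<int n}. x mod 2 = r}) \<le> int (card C)"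
    if occ: "\<And>x. x \<in> {0..<int n} \<Longrightarrow> x mod 2 = r \<Longrightarrow> x \<in> f ` C" for f :: "square \<Rightarrow> int" and r
  proof -
    let ?A = "{x \<in> f ` C. x mod 2 \<noteq> r}" and ?B = "{x \<in> {0..<int n}. x mod 2 = r}"
    have fin: "finite ?B" by (rule finite_subset[of _ "{0..<int n}"]) auto
    have "card ?A + card ?B = card (?A \<union> ?B)"
      by (rule card_Un_disjoint[symmetric]) (use fin in \<open>auto simp: finite_C\<close>)
    also have "\<dots> \<le> card (f ` C)"
      using occ by (intro card_mono) (auto simp: finite_C)
    also have "\<dots> \<le> card C" by (rule card_image_le[OF finite_C])
    finally show ?thesis by simp
  qed
  have "x \<in> fst ` C" if "x \<in> {0..<int n}" "x mod 2 = p" for x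
    using columns[OF that] by (force simp: column_occupied_def)
  note cols = *[where r = p, OF this]
  have "y \<in> snd ` C" if "y \<in> {0..<int n}" "y mod 2 = q" for y
    using rows[OF that] by (force simp: row_occupied_def)
  note rows = *[where r = q, OF this]
  have "int extra \<le> 2 * int (card C) - int n + 1"
    using cols rows card_parity_class[OF p, of n] card_parity_class[OF q, of n]
    unfolding extra_def by linarith
  then show ?thesis by linarith
qed

text \<open>The squares on difference diagonal \<open>\<delta>\<close> whose column and row both have the wrong parity lie on the
  sum diagonals of class \<open>opposite \<delta>\<close> modulo 4.\<close>

definition opposite :: "int \<Rightarrow> int" where
  "opposite \<delta> = \<delta> + 2 - 2 * p - (int n - 1)"

text \<open>Consider the squares on a free difference diagonal whose column and row have the wrong parity. If
  such a square lies on a free sum diagonal as well, it is covered along its column or its row,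
  which is therefore an extra line; different squares on one diagonal use different columns and rows.\<close>

lemma missing_sums_of_free_diff:
  assumes D: "D mod 2 = (q - p) mod 2" "D \<notin> diff_no ` C"
  shows "card {s \<in> residue_window (opposite D) (int n - 1 - \<bar>D\<bar>). s \<notin> sum_no n ` C} \<le> extra"
proof -
  define M where "M = {s \<in> residue_window (opposite D) (int n - 1 - \<bar>D\<bar>). s \<notin> sum_no n ` C}"
  define W where "W = {x \<in> fst ` C. x mod 2 \<noteq> p}"
  define W' where "W' = {y \<in> snd ` C. y mod 2 \<noteq> q}"
  have fin: "finite W" "finite W'" by (simp_all add: W_def W'_def finite_C)
  let ?x = "\<lambda>s. (s - D + int n - 1) div 2"
  have x: "2 * ?x s = s - D + int n - 1" "?x s mod 2 \<noteq> p" "(?x s + D) mod 2 \<noteq> q"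
    if "s \<in> M" for s
  proof -
    have "s mod 4 = opposite D mod 4" using that by (simp add: M_def residue_window_def)
    then have "4 dvd s - opposite D" by (simp add: mod_eq_dvd_iff)
    then obtain j where "s - opposite D = 4 * j" by (elim dvdE)
    then have j: "s - D + int n - 1 = 2 * (1 - p + 2 * j)" by (simp add: opposite_def)
    then have xs: "?x s = 1 - p + 2 * j" by simp
    show "2 * ?x s = s - D + int n - 1" using j xs by simp
    have "(1 - p + 2 * j) mod 2 = (1 - p) mod 2" by simp
    then show "?x s mod 2 \<noteq> p" using p unfolding xs by auto
    have "(1 - p + 2 * j + D) mod 2 = (1 - p + D) mod 2"
      by presburger
    also have "\<dots> = (1 - p + (q - p)) mod 2"
      using D(1) by (rule mod_add_cong[OF refl])
    finally show "(?x s + D) mod 2 \<noteq> q" using p q unfolding xs by auto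
  qed
  have covered: "?x s \<in> W \<or> ?x s + D \<in> W'" if s: "s \<in> M" for s
  proof -
    let ?v = "(?x s, ?x s + D)"
    have sb: "\<bar>s\<bar> \<le> int n - 1 - \<bar>D\<bar>" using s by (simp add: M_def residue_window_def)
    have tot: "sum_no n ?v = s" using x(1)[OF s] by (simp add: sum_no_def)
    have dif: "diff_no ?v = D" by (simp add: diff_no_def)
    have "?v \<in> board n" using sb x(1)[OF s] by (auto simp: board_def)
    then consider "?v \<in> C" | u where "u \<in> C" "queen_attacks u ?v" using dominated by blast
    then show ?thesis
    proof cases
      case 1
      then have "diff_no ?v \<in> diff_no ` C" by (rule imageI)
      then show ?thesis using D(2) unfolding dif by simp
    next
      case 2
      have "diff_no u \<in> diff_no ` C" "sum_no n u \<in> sum_no n ` C" using 2(1) by simp_all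
      then have "diff_no u \<noteq> D" "sum_no n u \<noteq> s" using D(2) s by (auto simp: M_def)
      then have "diff_no u \<noteq> diff_no ?v" "sum_no n u \<noteq> sum_no n ?v" unfolding dif tot .
      then have "snd u = ?x s + D \<or> fst u = ?x s"
        using 2(2) by (auto simp: queen_attacks_def diff_no_def sum_no_def)
      then have "?x s + D \<in> snd ` C \<or> ?x s \<in> fst ` C"
        using imageI[OF 2(1), of fst] imageI[OF 2(1), of snd] by (elim disjE) simp_all
      then show ?thesis using x(2,3)[OF s] unfolding W_def W'_def by blast
    qed
  qed
  have inj: "inj_on ?x M"
  proof (rule inj_onI)
    fix s s' assume s: "s \<in> M" "s' \<in> M" and "?x s = ?x s'"
    then show "s = s'" using x(1)[OF s(1)] x(1)[OF s(2)] by linarith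
  qed
  let ?A = "{s \<in> M. ?x s \<in> W}" and ?B = "{s \<in> M. ?x s + D \<in> W'}"
  have "M = ?A \<union> ?B" using covered by blast
  then have "card M = card (?A \<union> ?B)" by (rule arg_cong)
  also have "\<dots> \<le> card ?A + card ?B" by (rule card_Un_le)
  also have "card ?A \<le> card W"
  proof (rule card_inj_on_le[of ?x])
    show "inj_on ?x ?A" by (rule inj_on_subset[OF inj]) blast
  qed (auto simp: fin)
  also have "card ?B \<le> card W'"
  proof (rule card_inj_on_le[of "\<lambda>s. ?x s + D"])
    have "inj_on ?x ?B" by (rule inj_on_subset[OF inj]) blast
    then show "inj_on (\<lambda>s. ?x s + D) ?B" by (simp add: inj_on_def)
  qed (auto simp: fin)
  finally show ?thesis by (simp add: extra_def M_def W_def W'_def)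
qed

text \<open>The last condition is what a free diagonal at distance \<open>e\<close> forces on the sum diagonals.\<close>

definition occupied_radius :: "int \<Rightarrow> nat \<Rightarrow> bool" where
  "occupied_radius \<delta> e \<longleftrightarrow> e \<le> n \<and> residue_window \<delta> (int e - 1) \<subseteq> diff_no ` C \<and>
     card {s \<in> residue_window (opposite \<delta>) (int n - 1 - int e). s \<notin> sum_no n ` C} \<le> extra"

text \<open>Take the distance to the nearest free difference diagonal of the class. If there is none on the
  board, \<open>e = n\<close> works because no sum diagonal is then required.\<close>

lemma ex_occupied_radius:
  assumes \<delta>: "\<delta> mod 2 = (q - p) mod 2"
  shows "\<exists>e. occupied_radius \<delta> e"
proof (cases "residue_window \<delta> (int n - 1) \<subseteq> diff_no ` C")
  case True
  have "residue_window (opposite \<delta>) (int n - 1 - int n) = {}"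
    by (auto simp: residue_window_def)
  then have "card {s \<in> residue_window (opposite \<delta>) (int n - 1 - int n). s \<notin> sum_no n ` C} \<le> extra"
    by simp
  with True show ?thesis by (intro exI[of _ n]) (simp add: occupied_radius_def)
next
  case False
  define P where "P e \<longleftrightarrow> (\<exists>D. \<bar>D\<bar> = int e \<and> D mod 4 = \<delta> mod 4 \<and> D \<notin> diff_no ` C)" for e
  define e where "e = (LEAST e. P e)"
  obtain D0 where D0: "D0 \<in> residue_window \<delta> (int n - 1)" "D0 \<notin> diff_no ` C" using False by auto
  have P0: "P (nat \<bar>D0\<bar>)" using D0 by (auto simp: P_def residue_window_def)
  have "P e" unfolding e_def using P0 by (rule LeastI)
  have "e \<le> nat \<bar>D0\<bar>" unfolding e_def using P0 by (rule Least_le)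
  then have "e \<le> n" using D0 by (auto simp: residue_window_def)
  have "residue_window \<delta> (int e - 1) \<subseteq> diff_no ` C"
  proof
    fix k assume k: "k \<in> residue_window \<delta> (int e - 1)"
    then have "nat \<bar>k\<bar> < (LEAST e. P e)" unfolding residue_window_def e_def by simp linarith
    then have "\<not> P (nat \<bar>k\<bar>)" by (rule not_less_Least)
    then show "k \<in> diff_no ` C" using k by (auto simp: P_def residue_window_def)
  qed
  moreover obtain D where D: "\<bar>D\<bar> = int e" "D mod 4 = \<delta> mod 4" "D \<notin> diff_no ` C"
    using \<open>P e\<close> by (auto simp: P_def)
  have "D mod 2 = D mod 4 mod 2" "\<delta> mod 2 = \<delta> mod 4 mod 2" by (simp_all add: mod_mod_cancel)
  then have "D mod 2 = (q - p) mod 2" using D(2) \<delta> by simp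
  then have "card {s \<in> residue_window (opposite D) (int n - 1 - \<bar>D\<bar>). s \<notin> sum_no n ` C} \<le> extra"
    using D(3) by (rule missing_sums_of_free_diff)
  moreover have "residue_window (opposite D) = residue_window (opposite \<delta>)"
  proof -
    have "opposite D mod 4 = opposite \<delta> mod 4"
      using D(2) by (simp add: opposite_def mod_eq_dvd_iff)
    then show ?thesis by (auto simp: residue_window_def fun_eq_iff)
  qed
  ultimately show ?thesis using D(1) \<open>e \<le> n\<close> by (intro exI[of _ e]) (simp add: occupied_radius_def)
qed

end

section \<open>Weights on lines\<close>

text \<open>The line with number \<open>k\<close> is assigned \<open>z = \<bar>k\<bar> / n\<close>. It carries weight \<open>h z\<close> if it is a row or a
  column of the right parity. Diagonals carry \<open>f z\<close> or \<open>f' z\<close>: the functions \<open>f\<close> and \<open>f'\<close> belong to the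
  two residue classes of difference diagonals, and to the two classes of sum diagonals in such a way that a queen whose column
  and row both have the right parity meets two diagonals with the same function, while a queen with both
  parities wrong meets one of each. A queen with exactly one right parity meets no weighted diagonal.
  The Lipschitz bounds are asked for only where the weights are integrated later on, because the
  tabulated weights of diagonals drop to 0 within one cell further out.\<close>

locale weight_system =
  fixes h f f' :: "real \<Rightarrow> real" and R R' :: real
  assumes bounds: "z \<in> {0..1} \<Longrightarrow> 0 \<le> h z \<and> h z \<le> 1 \<and> 0 \<le> f z \<and> f z \<le> 1 \<and> 0 \<le> f' z \<and> f' z \<le> 1"
    and lipschitz: "2-lipschitz_on {0..1} h" "2-lipschitz_on {0..R} f" "2-lipschitz_on {0..R'} f'"
    and queen: "\<lbrakk>\<bar>x\<bar> < 1; \<bar>y\<bar> < 1\<rbrakk> \<Longrightarrow> h \<bar>x\<bar> + h \<bar>y\<bar> + f \<bar>(y - x) / 2\<bar> + f \<bar>(x + y) / 2\<bar> \<le> 1"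
    and queen': "\<lbrakk>\<bar>x\<bar> < 1; \<bar>y\<bar> < 1\<rbrakk> \<Longrightarrow> h \<bar>x\<bar> + h \<bar>y\<bar> + f' \<bar>(y - x) / 2\<bar> + f' \<bar>(x + y) / 2\<bar> \<le> 1"
    and stray: "\<lbrakk>\<bar>x\<bar> < 1; \<bar>y\<bar> < 1\<rbrakk> \<Longrightarrow> f \<bar>(y - x) / 2\<bar> + f' \<bar>(x + y) / 2\<bar> \<le> 1"

text \<open>Here \<open>A\<close> and \<open>B\<close> are the offsets of a queen's column and row from the required parities, and \<open>2 * k\<close> is
  the offset of the chosen class of difference diagonals from \<open>q - p\<close>.\<close>

lemma residue_cases:
  fixes A B k :: int
  shows "(4 dvd 2 * A \<longleftrightarrow> even A) \<and> (4 dvd 2 * B \<longleftrightarrow> even B) \<and>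
   (even A \<and> even B \<longrightarrow>
     (4 dvd B - A - 2 * k) = (\<not> 4 dvd B - A - 2 * k - 2) \<and>
     (4 dvd A + B - 2 * k) = (4 dvd B - A - 2 * k) \<and>
     (4 dvd A + B - 2 * k - 2) = (4 dvd B - A - 2 * k - 2)) \<and>
   (odd A \<and> odd B \<longrightarrow>
     (4 dvd B - A - 2 * k) = (\<not> 4 dvd B - A - 2 * k - 2) \<and>
     (4 dvd A + B - 2 * k) = (4 dvd B - A - 2 * k - 2) \<and>
     (4 dvd A + B - 2 * k - 2) = (4 dvd B - A - 2 * k)) \<and>
   (even A \<noteq> even B \<longrightarrow>
     \<not> 4 dvd B - A - 2 * k \<and> \<not> 4 dvd B - A - 2 * k - 2 \<and>
     \<not> 4 dvd A + B - 2 * k \<and> \<not> 4 dvd A + B - 2 * k - 2)"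
  by presburger


context parity_cover
begin

definition class_weight :: "(real \<Rightarrow> real) \<Rightarrow> int \<Rightarrow> int \<Rightarrow> real" where
  "class_weight g c k = (if k mod 4 = c mod 4 then g (\<bar>real_of_int k\<bar> / real n) else 0)"

lemma queen_weight_le_1:
  assumes W: "weight_system h f f' R R'" and u: "u \<in> C" and \<delta>: "\<delta> mod 2 = (q - p) mod 2"
  shows "class_weight h (2 * p - (int n - 1)) (col_no n u) + class_weight h (2 * q - (int n - 1)) (row_no n u)
     + (class_weight f \<delta> (diff_no u) + class_weight f' (\<delta> + 2) (diff_no u))
     + (class_weight f' (opposite \<delta>) (sum_no n u) + class_weight f (opposite (\<delta> + 2)) (sum_no n u)) \<le> 1"
proof -
  interpret weight_system h f f' R R' by (rule W)
  define A B where "A = fst u - p" and "B = snd u - q"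
  have "2 dvd \<delta> - (q - p)" using \<delta> by (simp add: mod_eq_dvd_iff)
  then obtain k where k: "\<delta> - (q - p) = 2 * k" by (elim dvdE)
  have mods: "col_no n u mod 4 = (2 * p - (int n - 1)) mod 4 \<longleftrightarrow> 4 dvd 2 * A"
    "row_no n u mod 4 = (2 * q - (int n - 1)) mod 4 \<longleftrightarrow> 4 dvd 2 * B"
    "diff_no u mod 4 = \<delta> mod 4 \<longleftrightarrow> 4 dvd B - A - 2 * k"
    "diff_no u mod 4 = (\<delta> + 2) mod 4 \<longleftrightarrow> 4 dvd B - A - 2 * k - 2"
  proof -
    have eqs: "col_no n u - (2 * p - (int n - 1)) = 2 * A" "row_no n u - (2 * q - (int n - 1)) = 2 * B"
      "diff_no u - \<delta> = B - A - 2 * k" "diff_no u - (\<delta> + 2) = B - A - 2 * k - 2"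
      using k by (simp_all add: col_no_def row_no_def diff_no_def A_def B_def)
    show "col_no n u mod 4 = (2 * p - (int n - 1)) mod 4 \<longleftrightarrow> 4 dvd 2 * A"
      "row_no n u mod 4 = (2 * q - (int n - 1)) mod 4 \<longleftrightarrow> 4 dvd 2 * B"
      "diff_no u mod 4 = \<delta> mod 4 \<longleftrightarrow> 4 dvd B - A - 2 * k"
      "diff_no u mod 4 = (\<delta> + 2) mod 4 \<longleftrightarrow> 4 dvd B - A - 2 * k - 2"
      by (simp_all only: mod_eq_dvd_iff eqs)
  qed
  have mods': "sum_no n u mod 4 = opposite \<delta> mod 4 \<longleftrightarrow> 4 dvd A + B - 2 * k - 2"
    "sum_no n u mod 4 = opposite (\<delta> + 2) mod 4 \<longleftrightarrow> 4 dvd A + B - 2 * k"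
  proof -
    have eqs: "sum_no n u - opposite \<delta> = A + B - 2 * k - 2 + 4 * p"
      "sum_no n u - opposite (\<delta> + 2) = A + B - 2 * k + 4 * (p - 1)"
      using k by (simp_all add: sum_no_def opposite_def A_def B_def)
    have *: "4 dvd m + 4 * j \<longleftrightarrow> 4 dvd m" for m j :: int
      by (rule dvd_add_left_iff) simp
    show "sum_no n u mod 4 = opposite \<delta> mod 4 \<longleftrightarrow> 4 dvd A + B - 2 * k - 2"
      "sum_no n u mod 4 = opposite (\<delta> + 2) mod 4 \<longleftrightarrow> 4 dvd A + B - 2 * k"
      by (simp_all only: mod_eq_dvd_iff eqs *)
  qed
  have ub: "u \<in> board n" using u C_board by blast
  define x y where "x = real_of_int (col_no n u) / real n" and "y = real_of_int (row_no n u) / real n"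
  have "\<bar>real_of_int (col_no n u)\<bar> < real n" "\<bar>real_of_int (row_no n u)\<bar> < real n"
    using board_lines_bounded(1,2)[OF ub] by linarith+
  then have xy: "\<bar>x\<bar> < 1" "\<bar>y\<bar> < 1"
    using n_pos by (simp_all add: x_def y_def abs_divide)
  define X Y D S where "X = \<bar>real_of_int (col_no n u)\<bar> / real n" and "Y = \<bar>real_of_int (row_no n u)\<bar> / real n"
    and "D = \<bar>real_of_int (diff_no u)\<bar> / real n" and "S = \<bar>real_of_int (sum_no n u)\<bar> / real n"
  have "real_of_int (row_no n u) - real_of_int (col_no n u) = 2 * real_of_int (diff_no u)"
    "real_of_int (col_no n u) + real_of_int (row_no n u) = 2 * real_of_int (sum_no n u)"
    using row_minus_col[of n u] row_plus_col[of n u] by linarith+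
  then have d: "(y - x) / 2 = real_of_int (diff_no u) / real n" "(x + y) / 2 = real_of_int (sum_no n u) / real n"
    by (simp_all add: x_def y_def diff_divide_distrib[symmetric] add_divide_distrib[symmetric])
  have DS: "\<bar>(y - x) / 2\<bar> = D" "\<bar>(x + y) / 2\<bar> = S" "\<bar>(- y - x) / 2\<bar> = S" "\<bar>(x + - y) / 2\<bar> = D"
  proof -
    have "(- y - x) / 2 = - ((x + y) / 2)" "(x + - y) / 2 = - ((y - x) / 2)" by (simp_all add: field_simps)
    with d show "\<bar>(y - x) / 2\<bar> = D" "\<bar>(x + y) / 2\<bar> = S" "\<bar>(- y - x) / 2\<bar> = S" "\<bar>(x + - y) / 2\<bar> = D"
      by (simp_all only: abs_minus_cancel) (simp_all add: D_def S_def abs_divide)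
  qed
  have XY: "\<bar>x\<bar> = X" "\<bar>y\<bar> = Y" by (simp_all add: x_def y_def X_def Y_def abs_divide)
  have y': "\<bar>- y\<bar> < 1" using xy by simp
  have q: "h X + h Y + f D + f S \<le> 1" "h X + h Y + f' D + f' S \<le> 1" "f D + f' S \<le> 1" "f S + f' D \<le> 1"
    using queen[OF xy] queen'[OF xy] stray[OF xy] stray[OF xy(1) y'] unfolding DS XY by simp_all
  have h1: "h X \<le> 1" "h Y \<le> 1"
    using bounds[of X] bounds[of Y] xy unfolding XY[symmetric] by auto
  show ?thesis
    unfolding class_weight_def X_def[symmetric] Y_def[symmetric] D_def[symmetric] S_def[symmetric] mods mods'
    using residue_cases[of A B k] q h1
    by (cases "even A"; cases "even B"; cases "4 dvd B - A - 2 * k") simp_all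
qed

text \<open>The error \<open>13 / 2\<close> is the sampling error \<open>2 * L + 5 / 2 * B\<close> for \<open>L = 2\<close> and \<open>B = 1\<close>; each missing line
  costs at most 1.\<close>

lemma weight_of_window_le:
  fixes g :: "real \<Rightarrow> real" and \<phi> :: "square \<Rightarrow> int"
  assumes T: "0 \<le> T" "T \<le> 1" "real n * T \<le> a + 1" "a \<le> int n - 1"
    and lip: "2-lipschitz_on {0..T} g" and g: "\<And>z. z \<in> {0..1} \<Longrightarrow> 0 \<le> g z \<and> g z \<le> 1"
    and \<phi>: "\<And>u. u \<in> C \<Longrightarrow> \<bar>\<phi> u\<bar> \<le> int n - 1"
    and missing: "card {k \<in> residue_window c a. k \<notin> \<phi> ` C} \<le> m"
  shows "real n / 2 * integral {0..T} g - 13 / 2 - real m \<le> (\<Sum>u\<in>C. class_weight g c (\<phi> u))"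
proof -
  let ?M = "{k \<in> residue_window c a. k \<notin> \<phi> ` C}" and ?A = "{k \<in> residue_window c a. k \<in> \<phi> ` C}"
  let ?g = "\<lambda>k. g (\<bar>real_of_int k\<bar> / real n)"
  have unit: "\<bar>real_of_int k\<bar> / real n \<in> {0..1}" if "\<bar>k\<bar> \<le> int n - 1" for k
  proof -
    have "\<bar>real_of_int k\<bar> \<le> real n" using that by linarith
    then show ?thesis using n_pos by simp
  qed
  have g01: "0 \<le> ?g k \<and> ?g k \<le> 1" if "\<bar>k\<bar> \<le> int n - 1" for k
    using g[OF unit[OF that]] .
  have win: "\<bar>k\<bar> \<le> int n - 1" if "k \<in> residue_window c a" for k
    using that T(4) by (simp add: residue_window_def)
  have "real n / 2 * integral {0..T} g - 2 * 2 - 5 / 2 * 1 \<le> sum ?g (residue_window c a)"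
    by (rule sum_residue_window_ge_integral) (use n_pos T lip g g01[OF win] in auto)
  also have "residue_window c a = ?A \<union> ?M" by blast
  also have "sum ?g (?A \<union> ?M) = sum ?g ?A + sum ?g ?M"
    by (rule sum.union_disjoint) auto
  also have "sum ?g ?M \<le> real (card ?M) * 1"
    using g01 win by (intro sum_bounded_above) auto
  also have "sum ?g ?A \<le> (\<Sum>u\<in>C. class_weight g c (\<phi> u))"
    unfolding class_weight_def
    by (rule sum_lines_le_sum_queens) (use finite_C g01 \<phi> in \<open>auto simp: residue_window_def\<close>)
  finally show ?thesis using missing by simp
qed

text \<open>Double counting of the collected weight. Queens collect at most 1 each; the occupied lines of the six
  families (columns, rows, two classes each of difference and sum diagonals) collect at least the
  integrals, up to the error \<open>39 = 6 * 13 / 2\<close> and up to \<open>extra\<close> missing sum diagonals in each class.\<close>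

lemma card_ge_weight_integrals:
  fixes e e' :: nat
  assumes W: "weight_system h f f' R R'" and \<delta>: "\<delta> mod 2 = (q - p) mod 2"
    and r: "occupied_radius \<delta> e" and r': "occupied_radius (\<delta> + 2) e'"
    and t: "t = real e / real n" and t': "t' = 1 - real e' / real n"
    and R: "t \<le> R" "t' \<le> R" "1 - t \<le> R'" "1 - t' \<le> R'"
  shows "real n / 2 * (2 * integral {0..1} h + (integral {0..t} f + integral {0..1 - t} f')
     + (integral {0..t'} f + integral {0..1 - t'} f')) - 39 - 2 * real extra \<le> real (card C)"
proof -
  have e: "e \<le> n" "residue_window \<delta> (int e - 1) \<subseteq> diff_no ` C"
      "card {s \<in> residue_window (opposite \<delta>) (int n - 1 - int e). s \<notin> sum_no n ` C} \<le> extra"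
    and e': "e' \<le> n" "residue_window (\<delta> + 2) (int e' - 1) \<subseteq> diff_no ` C"
      "card {s \<in> residue_window (opposite (\<delta> + 2)) (int n - 1 - int e'). s \<notin> sum_no n ` C} \<le> extra"
    using r r' by (simp_all add: occupied_radius_def)
  interpret weight_system h f f' R R' by (rule W)
  have t01: "0 \<le> t" "t \<le> 1" "0 \<le> t'" "t' \<le> 1"
    using e(1) e'(1) n_pos by (simp_all add: t t')
  have nt: "real n * t = real e" "real n * (1 - t) = real n - real e"
    "real n * t' = real n - real e'" "real n * (1 - t') = real e'"
    using n_pos by (simp_all add: t t' right_diff_distrib)
  have lines: "\<bar>col_no n u\<bar> \<le> int n - 1" "\<bar>row_no n u\<bar> \<le> int n - 1" "\<bar>diff_no u\<bar> \<le> int n - 1" "\<bar>sum_no n u\<bar> \<le> int n - 1"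
    if "u \<in> C" for u
    using board_lines_bounded[of u n] C_board that by auto
  have cols: "residue_window (2 * p - (int n - 1)) (int n - 1) \<subseteq> col_no n ` C"
  proof
    fix k assume k: "k \<in> residue_window (2 * p - (int n - 1)) (int n - 1)"
    then have "4 dvd k - (2 * p - (int n - 1))" by (simp add: residue_window_def mod_eq_dvd_iff)
    then obtain j where "k - (2 * p - (int n - 1)) = 4 * j" by (elim dvdE)
    then have j: "k = 2 * (2 * j + p) - (int n - 1)" by simp
    have "2 * j + p \<in> {0..<int n}" using k unfolding j residue_window_def by auto
    moreover have "(2 * j + p) mod 2 = p" using p by auto
    ultimately obtain y where "(2 * j + p, y) \<in> C" using columns unfolding column_occupied_def by blast
    then have "col_no n (2 * j + p, y) \<in> col_no n ` C" by (rule imageI)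
    then show "k \<in> col_no n ` C" by (simp add: col_no_def j)
  qed
  have rws: "residue_window (2 * q - (int n - 1)) (int n - 1) \<subseteq> row_no n ` C"
  proof
    fix k assume k: "k \<in> residue_window (2 * q - (int n - 1)) (int n - 1)"
    then have "4 dvd k - (2 * q - (int n - 1))" by (simp add: residue_window_def mod_eq_dvd_iff)
    then obtain j where "k - (2 * q - (int n - 1)) = 4 * j" by (elim dvdE)
    then have j: "k = 2 * (2 * j + q) - (int n - 1)" by simp
    have "2 * j + q \<in> {0..<int n}" using k unfolding j residue_window_def by auto
    moreover have "(2 * j + q) mod 2 = q" using q by auto
    ultimately obtain x where "(x, 2 * j + q) \<in> C" using rows unfolding row_occupied_def by blast
    then have "row_no n (x, 2 * j + q) \<in> row_no n ` C" by (rule imageI)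
    then show "k \<in> row_no n ` C" by (simp add: row_no_def j)
  qed
  let ?I = "\<lambda>g T. real n / 2 * integral {0..T} g"
  have h01: "0 \<le> h z \<and> h z \<le> 1" and f01: "0 \<le> f z \<and> f z \<le> 1" and f'01: "0 \<le> f' z \<and> f' z \<le> 1"
    if "z \<in> {0..1}" for z using bounds[OF that] by simp_all
  have "?I h 1 - 13 / 2 - real 0 \<le> (\<Sum>u\<in>C. class_weight h (2 * p - (int n - 1)) (col_no n u))"
  proof (rule weight_of_window_le[where a = "int n - 1"])
    show "2-lipschitz_on {0..1} h"
      by (rule lipschitz_on_subset[OF lipschitz(1)]) (use R in simp)
    show "real n * 1 \<le> real_of_int (int n - 1) + 1" using nt n_pos by simp
  qed (use t01 h01 lines no_missing[OF cols] in simp_all)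
  moreover have "?I h 1 - 13 / 2 - real 0 \<le> (\<Sum>u\<in>C. class_weight h (2 * q - (int n - 1)) (row_no n u))"
  proof (rule weight_of_window_le[where a = "int n - 1"])
    show "2-lipschitz_on {0..1} h"
      by (rule lipschitz_on_subset[OF lipschitz(1)]) (use R in simp)
    show "real n * 1 \<le> real_of_int (int n - 1) + 1" using nt n_pos by simp
  qed (use t01 h01 lines no_missing[OF rws] in simp_all)
  moreover have "?I f t - 13 / 2 - real 0 \<le> (\<Sum>u\<in>C. class_weight f \<delta> (diff_no u))"
  proof (rule weight_of_window_le[where a = "int e - 1"])
    show "2-lipschitz_on {0..t} f"
      by (rule lipschitz_on_subset[OF lipschitz(2)]) (use R in simp)
    show "real n * t \<le> real_of_int (int e - 1) + 1" using nt n_pos by simp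
  qed (use t01 f01 e lines no_missing[OF e(2)] in simp_all)
  moreover have "?I f' (1 - t') - 13 / 2 - real 0 \<le> (\<Sum>u\<in>C. class_weight f' (\<delta> + 2) (diff_no u))"
  proof (rule weight_of_window_le[where a = "int e' - 1"])
    show "2-lipschitz_on {0..1 - t'} f'"
      by (rule lipschitz_on_subset[OF lipschitz(3)]) (use R in simp)
    show "real n * (1 - t') \<le> real_of_int (int e' - 1) + 1" using nt n_pos by simp
  qed (use t01 f'01 e' lines no_missing[OF e'(2)] in simp_all)
  moreover have "?I f' (1 - t) - 13 / 2 - real extra \<le> (\<Sum>u\<in>C. class_weight f' (opposite \<delta>) (sum_no n u))"
  proof (rule weight_of_window_le[where a = "int n - 1 - int e"])
    show "2-lipschitz_on {0..1 - t} f'"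
      by (rule lipschitz_on_subset[OF lipschitz(3)]) (use R in simp)
    show "real n * (1 - t) \<le> real_of_int (int n - 1 - int e) + 1" using nt n_pos by simp
  qed (use t01 f'01 e lines  in simp_all)
  moreover have "?I f t' - 13 / 2 - real extra \<le> (\<Sum>u\<in>C. class_weight f (opposite (\<delta> + 2)) (sum_no n u))"
  proof (rule weight_of_window_le[where a = "int n - 1 - int e'"])
    show "2-lipschitz_on {0..t'} f"
      by (rule lipschitz_on_subset[OF lipschitz(2)]) (use R in simp)
    show "real n * t' \<le> real_of_int (int n - 1 - int e') + 1" using nt n_pos by simp
  qed (use t01 f01 e' lines  in simp_all)
  moreover have "(\<Sum>u\<in>C. class_weight h (2 * p - (int n - 1)) (col_no n u) + class_weight h (2 * q - (int n - 1)) (row_no n u)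
     + (class_weight f \<delta> (diff_no u) + class_weight f' (\<delta> + 2) (diff_no u))
     + (class_weight f' (opposite \<delta>) (sum_no n u) + class_weight f (opposite (\<delta> + 2)) (sum_no n u))) \<le> real (card C) * 1"
    by (rule sum_bounded_above) (rule queen_weight_le_1[OF W _ \<delta>])
  ultimately show ?thesis
    unfolding sum.distrib by (simp add: algebra_simps)
qed

end

section \<open>Quadratic weights\<close>

lemma quadratic_lipschitz:
  fixes a b :: real
  assumes "\<bar>b\<bar> \<le> 1"
  shows "2-lipschitz_on {0..1} (\<lambda>z. a + b * z\<^sup>2)"
proof (rule lipschitz_onI)
  fix z w :: real
  assume zw: "z \<in> {0..1}" "w \<in> {0..1}"
  have "a + b * z\<^sup>2 - (a + b * w\<^sup>2) = b * (z + w) * (z - w)"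
    by (simp add: power2_eq_square algebra_simps)
  then have "\<bar>a + b * z\<^sup>2 - (a + b * w\<^sup>2)\<bar> = \<bar>b\<bar> * \<bar>z + w\<bar> * \<bar>z - w\<bar>"
    by (simp add: abs_mult)
  also have "\<dots> \<le> 1 * 2 * \<bar>z - w\<bar>"
    using assms zw by (intro mult_right_mono mult_mono) auto
  finally show "dist (a + b * z\<^sup>2) (a + b * w\<^sup>2) \<le> 2 * dist z w" by (simp add: dist_real_def)
qed simp

lemma integral_quadratic:
  fixes a b T :: real
  assumes "0 \<le> T"
  shows "integral {0..T} (\<lambda>z. a + b * z\<^sup>2) = a * T + b * T ^ 3 / 3"
proof -
  let ?F = "\<lambda>z. a * z + b * z ^ 3 / 3"
  have "((\<lambda>z. a + b * z\<^sup>2) has_integral ?F T - ?F 0) {0..T}"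
    by (rule fundamental_theorem_of_calculus[OF assms])
      (auto intro!: derivative_eq_intros simp: has_real_derivative_iff_has_vector_derivative[symmetric]
        power2_eq_square)
  then show ?thesis by (simp add: integral_unique)
qed

lemma integral_square: "0 \<le> T \<Longrightarrow> integral {0..T} (\<lambda>z. z\<^sup>2) = T ^ 3 / (3::real)"
  using integral_quadratic[of T 0 1] by simp

lemma integral_half_minus_square:
  "0 \<le> T \<Longrightarrow> integral {0..T} (\<lambda>z. 1 / 2 - z\<^sup>2 / 2) = T / 2 - T ^ 3 / (6::real)"
  using integral_quadratic[of T "1 / 2" "- 1 / 2"] by simp

lemma integral_quarter_square: "0 \<le> T \<Longrightarrow> integral {0..T} (\<lambda>z. z\<^sup>2 / 4) = T ^ 3 / (12::real)"
  using integral_quadratic[of T 0 "1 / 4"] by simp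

text \<open>The parallelogram law behind the quadratic weights.\<close>

lemma sum_of_squared_diagonals: "((y - x) / 2)\<^sup>2 + ((x + y) / 2)\<^sup>2 = x\<^sup>2 / 2 + y\<^sup>2 / (2::real)"
  by (simp add: power2_eq_square field_simps)

text \<open>By the parallelogram law a queen with both parities right collects exactly 1. Weight that grows
  towards the outside makes the total large when the required diagonals reach far out, that is, when
  \<open>t (1 - t) + t' (1 - t')\<close> is less than \<open>1 / 3\<close>.\<close>

lemma outer_weights: "weight_system (\<lambda>z. 1 / 2 - z\<^sup>2 / 2) (\<lambda>z. z\<^sup>2) (\<lambda>z. z\<^sup>2) 1 1"
proof
  fix z :: real assume "z \<in> {0..1}"
  then have "0 \<le> z\<^sup>2" "z\<^sup>2 \<le> 1" by (auto intro: power_le_one)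
  then show "0 \<le> 1 / 2 - z\<^sup>2 / 2 \<and> 1 / 2 - z\<^sup>2 / 2 \<le> 1 \<and> 0 \<le> z\<^sup>2 \<and> z\<^sup>2 \<le> 1 \<and> 0 \<le> z\<^sup>2 \<and> z\<^sup>2 \<le> 1"
    by (intro conjI; linarith)
next
  fix x y :: real assume xy: "\<bar>x\<bar> < 1" "\<bar>y\<bar> < 1"
  then have "x\<^sup>2 \<le> 1" "y\<^sup>2 \<le> 1" by (simp_all add: abs_square_le_1)
  then show "\<bar>(y - x) / 2\<bar>\<^sup>2 + \<bar>(x + y) / 2\<bar>\<^sup>2 \<le> 1"
    using sum_of_squared_diagonals[of y x] unfolding power2_abs by linarith
  show "1 / 2 - \<bar>x\<bar>\<^sup>2 / 2 + (1 / 2 - \<bar>y\<bar>\<^sup>2 / 2) + \<bar>(y - x) / 2\<bar>\<^sup>2 + \<bar>(x + y) / 2\<bar>\<^sup>2 \<le> 1"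
    using sum_of_squared_diagonals[of y x] unfolding power2_abs by linarith
next
  show "2-lipschitz_on {0..1::real} (\<lambda>z. 1 / 2 - z\<^sup>2 / 2)" "2-lipschitz_on {0..1::real} (\<lambda>z. z\<^sup>2)"
    using quadratic_lipschitz[of "- 1 / 2" "1 / 2"] quadratic_lipschitz[of 1 0] by simp_all
qed

text \<open>Weight that decreases towards the outside succeeds in the opposite case.\<close>

lemma inner_weights: "weight_system (\<lambda>z. z\<^sup>2 / 4) (\<lambda>z. 1 / 2 - z\<^sup>2 / 2) (\<lambda>z. 1 / 2 - z\<^sup>2 / 2) 1 1"
proof
  fix z :: real assume "z \<in> {0..1}"
  then have "0 \<le> z\<^sup>2" "z\<^sup>2 \<le> 1" by (auto intro: power_le_one)
  then show "0 \<le> z\<^sup>2 / 4 \<and> z\<^sup>2 / 4 \<le> 1 \<and> 0 \<le> 1 / 2 - z\<^sup>2 / 2 \<and> 1 / 2 - z\<^sup>2 / 2 \<le> 1 \<and>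
      0 \<le> 1 / 2 - z\<^sup>2 / 2 \<and> 1 / 2 - z\<^sup>2 / 2 \<le> 1"
    by (intro conjI; linarith)
next
  fix x y :: real
  have "0 \<le> ((y - x) / 2)\<^sup>2" "0 \<le> ((x + y) / 2)\<^sup>2" by simp_all
  then show "1 / 2 - \<bar>(y - x) / 2\<bar>\<^sup>2 / 2 + (1 / 2 - \<bar>(x + y) / 2\<bar>\<^sup>2 / 2) \<le> 1"
    unfolding power2_abs by linarith
  show "\<bar>x\<bar>\<^sup>2 / 4 + \<bar>y\<bar>\<^sup>2 / 4 + (1 / 2 - \<bar>(y - x) / 2\<bar>\<^sup>2 / 2) + (1 / 2 - \<bar>(x + y) / 2\<bar>\<^sup>2 / 2) \<le> 1"
    using sum_of_squared_diagonals[of y x] unfolding power2_abs by linarith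
next
  show "2-lipschitz_on {0..1::real} (\<lambda>z. z\<^sup>2 / 4)" "2-lipschitz_on {0..1::real} (\<lambda>z. 1 / 2 - z\<^sup>2 / 2)"
    using quadratic_lipschitz[of "1 / 4" 0] quadratic_lipschitz[of "- 1 / 2" "1 / 2"] by simp_all
qed

section \<open>Piecewise linear functions\<close>

definition node :: "int list \<Rightarrow> nat \<Rightarrow> int" where
  "node t k = (if k < length t then t ! k else 0)"

definition interp :: "int list \<Rightarrow> real \<Rightarrow> real" where
  "interp t x = (let k = nat \<lfloor>x\<rfloor>; r = x - real k in
     (1 - r) * real_of_int (node t k) + r * real_of_int (node t (Suc k)))"

lemma interp_cell:
  assumes "0 \<le> r" "r \<le> 1"
  shows "interp t (real k + r) = (1 - r) * real_of_int (node t k) + r * real_of_int (node t (Suc k))"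
proof (cases "r = 1")
  case True
  have "\<lfloor>real k + 1\<rfloor> = int (Suc k)" by linarith
  moreover have "nat (int k + 1) = Suc k" by simp
  ultimately show ?thesis using True by (simp add: interp_def Let_def)
next
  case False
  then have "\<lfloor>real k + r\<rfloor> = int k" using assms by linarith
  then show ?thesis by (simp add: interp_def Let_def)
qed

lemma interp_nat: "interp t (real k) = real_of_int (node t k)"
  using interp_cell[of 0 t k] by simp

lemma interp_bounds:
  assumes "0 \<le> x" "\<And>k. lo \<le> node t k" "\<And>k. node t k \<le> hi"
  shows "real_of_int lo \<le> interp t x" "interp t x \<le> real_of_int hi"
proof -
  define k where "k = nat \<lfloor>x\<rfloor>"
  define r where "r = x - real k"
  have r: "0 \<le> r" "r \<le> 1" using assms(1) unfolding r_def k_def by linarith+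
  have x: "interp t x = (1 - r) * real_of_int (node t k) + r * real_of_int (node t (Suc k))"
    using interp_cell[OF r, of t k] by (simp add: r_def)
  have "(1 - r) * real_of_int lo \<le> (1 - r) * real_of_int (node t k)"
    "r * real_of_int lo \<le> r * real_of_int (node t (Suc k))"
    "(1 - r) * real_of_int (node t k) \<le> (1 - r) * real_of_int hi"
    "r * real_of_int (node t (Suc k)) \<le> r * real_of_int hi"
    using r assms(2,3) by (intro mult_left_mono; simp)+
  then show "real_of_int lo \<le> interp t x" "interp t x \<le> real_of_int hi"
    unfolding x by (simp_all add: algebra_simps)
qed

definition cellwise_affine :: "(real \<Rightarrow> real) \<Rightarrow> bool" where
  "cellwise_affine g \<longleftrightarrow> (\<forall>k::int. \<forall>r. 0 \<le> r \<longrightarrow> r \<le> 1 \<longrightarrow>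
     g (real_of_int k + r) = (1 - r) * g (real_of_int k) + r * g (real_of_int (k + 1)))"

lemma cellwise_affineD:
  assumes "cellwise_affine g" "0 \<le> r" "r \<le> 1" "x = real_of_int k + r"
  shows "g x = (1 - r) * g (real_of_int k) + r * g (real_of_int (k + 1))"
  using assms unfolding cellwise_affine_def by blast

lemma cellwise_affine_interp_abs: "cellwise_affine (\<lambda>x. interp t \<bar>x\<bar>)"
  unfolding cellwise_affine_def
proof (intro allI impI)
  fix k :: int and r :: real
  assume r: "0 \<le> r" "r \<le> 1"
  show "interp t \<bar>real_of_int k + r\<bar>
      = (1 - r) * interp t \<bar>real_of_int k\<bar> + r * interp t \<bar>real_of_int (k + 1)\<bar>"
  proof (cases "0 \<le> k")
    case True
    then obtain m where k: "k = int m" by (metis nonneg_int_cases)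
    have "\<bar>real_of_int k + r\<bar> = real m + r" "\<bar>real_of_int k\<bar> = real m"
      "\<bar>real_of_int (k + 1)\<bar> = real (Suc m)" using r k by simp_all
    then show ?thesis using interp_cell[OF r, of t m] by (simp only: interp_nat)
  next
    case False
    then obtain m where k: "k = - int (Suc m)" by (metis not_le negD)
    have *: "\<bar>real_of_int k + r\<bar> = real m + (1 - r)" "\<bar>real_of_int k\<bar> = real (Suc m)"
      "\<bar>real_of_int (k + 1)\<bar> = real m" using r k by simp_all
    show ?thesis using interp_cell[of "1 - r" t m] r unfolding * interp_nat by simp
  qed
qed

text \<open>The lines \<open>x = i\<close>, \<open>y = j\<close>, \<open>x + y = k\<close> and \<open>y - x = k\<close> with integral \<open>i\<close>, \<open>j\<close>, \<open>k\<close> cut each unit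
  square along its two diagonals into four triangles. The sum is affine on each triangle, so it suffices
  to bound it at the corners and at the centre of the square.\<close>

lemma cellwise_affine_le:
  fixes h f :: "real \<Rightarrow> real" and m :: int
  assumes h: "cellwise_affine h" and f: "cellwise_affine f"
    and corner: "\<And>i j. \<lbrakk>0 \<le> i; i \<le> m; 0 \<le> j; j \<le> m\<rbrakk> \<Longrightarrow>
      h (of_int i) + h (of_int j) + f (of_int (j - i)) + f (of_int (i + j)) \<le> K"
    and centre: "\<And>i j. \<lbrakk>0 \<le> i; i < m; 0 \<le> j; j < m\<rbrakk> \<Longrightarrow>
      h (of_int i) + h (of_int (i + 1)) + h (of_int j) + h (of_int (j + 1))
        + 2 * f (of_int (j - i)) + 2 * f (of_int (i + j + 1)) \<le> 2 * K"
    and x: "0 \<le> x" "x < of_int m" and y: "0 \<le> y" "y < of_int m"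
  shows "h x + h y + f (y - x) + f (x + y) \<le> K"
proof -
  define i j a b where "i = \<lfloor>x\<rfloor>" and "j = \<lfloor>y\<rfloor>" and "a = x - of_int i" and "b = y - of_int j"
  have a: "0 \<le> a" "a \<le> 1" and b: "0 \<le> b" "b \<le> 1"
    unfolding a_def b_def i_def j_def by linarith+
  have ij: "0 \<le> i" "i < m" "0 \<le> j" "j < m"
    using x y unfolding i_def j_def by linarith+
  have hx: "h x = (1 - a) * h (of_int i) + a * h (of_int (i + 1))"
    by (rule cellwise_affineD[OF h a]) (simp add: a_def)
  have hy: "h y = (1 - b) * h (of_int j) + b * h (of_int (j + 1))"
    by (rule cellwise_affineD[OF h b]) (simp add: b_def)
  define M where "M = h (of_int i) + h (of_int (i + 1)) + h (of_int j) + h (of_int (j + 1))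
        + 2 * f (of_int (j - i)) + 2 * f (of_int (i + j + 1))"
  define V where "V i j = h (of_int i) + h (of_int j) + f (of_int (j - i)) + f (of_int (i + j))" for i j
  have V: "V i j \<le> K" "V (i + 1) j \<le> K" "V i (j + 1) \<le> K" "V (i + 1) (j + 1) \<le> K"
    unfolding V_def using ij by (intro corner; simp)+
  have M: "M \<le> 2 * K" unfolding M_def using ij by (intro centre)
  have combine: "h x + h y + f (y - x) + f (x + y) \<le> K"
    if "h x + h y + f (y - x) + f (x + y) = l1 * A + l2 * B + l3 * M" "A \<le> K" "B \<le> K"
      "0 \<le> l1" "0 \<le> l2" "0 \<le> l3" "l1 + l2 + 2 * l3 = 1" for A B l1 l2 l3
  proof -
    have "l1 * A + l2 * B + l3 * M \<le> l1 * K + l2 * K + l3 * (2 * K)"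
      using that M by (intro add_mono mult_left_mono) auto
    also have "\<dots> = (l1 + l2 + 2 * l3) * K" by (simp add: algebra_simps)
    finally show ?thesis using that by simp
  qed
  have sum_le: "f (x + y) = (1 - (a + b)) * f (of_int (i + j)) + (a + b) * f (of_int (i + j + 1))"
    if "a + b \<le> 1"
    by (rule cellwise_affineD[OF f]) (use that a b in \<open>auto simp: a_def b_def\<close>)
  have sum_ge: "f (x + y) = (1 - (a + b - 1)) * f (of_int (i + j + 1)) + (a + b - 1) * f (of_int (i + j + 1 + 1))"
    if "1 \<le> a + b"
    by (rule cellwise_affineD[OF f]) (use that a b in \<open>auto simp: a_def b_def\<close>)
  have diff_ge: "f (y - x) = (1 - (b - a)) * f (of_int (j - i)) + (b - a) * f (of_int (j - i + 1))"
    if "a \<le> b"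
    by (rule cellwise_affineD[OF f]) (use that a b in \<open>auto simp: a_def b_def\<close>)
  have diff_le: "f (y - x) = (1 - (1 + b - a)) * f (of_int (j - i - 1)) + (1 + b - a) * f (of_int (j - i - 1 + 1))"
    if "b \<le> a"
    by (rule cellwise_affineD[OF f]) (use that a b in \<open>auto simp: a_def b_def\<close>)
  have idx: "i + (j + 1) = i + j + 1" "i + 1 + j = i + j + 1" "i + 1 + (j + 1) = i + j + 1 + 1"
    "j + 1 - i = j - i + 1" "j - (i + 1) = j - i - 1" "j + 1 - (i + 1) = j - i" "j - i - 1 + 1 = j - i"
    by simp_all
  note eqs = V_def M_def idx hx hy
  consider "b \<le> a" "a + b \<le> 1" | "b \<le> a" "1 \<le> a + b" | "a \<le> b" "a + b \<le> 1" | "a \<le> b" "1 \<le> a + b"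
    by linarith
  then show ?thesis
  proof cases
    case 1
    show ?thesis
      by (rule combine[of "1 - a - b" "V i j" "a - b" "V (i + 1) j" b])
        (use 1 a b V in \<open>simp_all only: eqs sum_le diff_le\<close>, (simp add: algebra_simps)+)
  next
    case 2
    show ?thesis
      by (rule combine[of "a - b" "V (i + 1) j" "a + b - 1" "V (i + 1) (j + 1)" "1 - a"])
        (use 2 a b V in \<open>simp_all only: eqs sum_ge diff_le\<close>, (simp add: algebra_simps)+)
  next
    case 3
    show ?thesis
      by (rule combine[of "1 - a - b" "V i j" "b - a" "V i (j + 1)" a])
        (use 3 a b V in \<open>simp_all only: eqs sum_le diff_ge\<close>, (simp add: algebra_simps)+)
  next
    case 4
    show ?thesis
      by (rule combine[of "b - a" "V i (j + 1)" "a + b - 1" "V (i + 1) (j + 1)" "1 - b"])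
        (use 4 a b V in \<open>simp_all only: eqs sum_ge diff_ge\<close>, (simp add: algebra_simps)+)
  qed
qed

text \<open>The slope on each cell is a difference of neighbouring nodes.\<close>

lemma interp_lipschitz:
  assumes "\<And>k. k < m \<Longrightarrow> \<bar>node t (Suc k) - node t k\<bar> \<le> L" and "0 \<le> L"
  shows "(real_of_int L)-lipschitz_on {0..real m} (interp t)"
  using assms(1)
proof (induction m)
  case 0
  then show ?case using assms(2) by (simp add: lipschitz_on_def)
next
  case (Suc m)
  have "(real_of_int L)-lipschitz_on {real m..real (Suc m)} (interp t)"
  proof (rule lipschitz_onI)
    fix x y assume xy: "x \<in> {real m..real (Suc m)}" "y \<in> {real m..real (Suc m)}"
    let ?d = "real_of_int (node t (Suc m)) - real_of_int (node t m)"
    have z: "interp t z = real_of_int (node t m) + (z - real m) * ?d" if "z \<in> {real m..real (Suc m)}" for z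
      using interp_cell[of "z - real m" t m] that by (simp add: algebra_simps)
    have d: "\<bar>?d\<bar> \<le> real_of_int L" using Suc.prems[of m] by linarith
    have "interp t x - interp t y = (x - y) * ?d"
      unfolding z[OF xy(1)] z[OF xy(2)] by (simp add: algebra_simps)
    then have "dist (interp t x) (interp t y) = \<bar>x - y\<bar> * \<bar>?d\<bar>"
      by (simp add: dist_real_def abs_mult)
    also have "\<dots> \<le> \<bar>x - y\<bar> * real_of_int L" using d by (intro mult_left_mono) auto
    finally show "dist (interp t x) (interp t y) \<le> real_of_int L * dist x y"
      by (simp add: dist_real_def mult.commute)
  qed (use assms(2) in simp)
  then show ?case
    using lipschitz_on_concat[of "real_of_int L" 0 "real m" "interp t" "real (Suc m)" "interp t"] Suc
    by simp
qed

lemma interp_cell_has_integral: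
  assumes P: "0 < P" and r: "0 \<le> r" "r \<le> 1"
  shows "((\<lambda>z. interp t (P * z)) has_integral
     (r * real_of_int (node t k) + r\<^sup>2 / 2 * (real_of_int (node t (Suc k)) - real_of_int (node t k))) / P)
     {real k / P..(real k + r) / P}"
proof -
  let ?u = "real_of_int (node t k)" and ?d = "real_of_int (node t (Suc k)) - real_of_int (node t k)"
  let ?F = "\<lambda>z. z * ?u + (P * z - real k)\<^sup>2 / (2 * P) * ?d"
  have "((\<lambda>z. interp t (P * z)) has_integral ?F ((real k + r) / P) - ?F (real k / P))
     {real k / P..(real k + r) / P}"
  proof (rule fundamental_theorem_of_calculus)
    show "real k / P \<le> (real k + r) / P" using P r by (simp add: divide_right_mono)
    fix z assume z: "z \<in> {real k / P..(real k + r) / P}"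
    then have "0 \<le> P * z - real k" "P * z - real k \<le> 1"
      using P r by (auto simp: field_simps)
    then have "interp t (P * z) = ?u + (P * z - real k) * ?d"
      using interp_cell[of "P * z - real k" t k] by (simp add: algebra_simps)
    moreover have "(?F has_real_derivative ?u + (P * z - real k) * ?d) (at z within {real k / P..(real k + r) / P})"
      using P by (auto intro!: derivative_eq_intros simp: field_simps)
    ultimately show "(?F has_vector_derivative interp t (P * z)) (at z within {real k / P..(real k + r) / P})"
      by (simp add: has_real_derivative_iff_has_vector_derivative)
  qed
  moreover have "?F ((real k + r) / P) - ?F (real k / P) = (r * ?u + r\<^sup>2 / 2 * ?d) / P"
    using P by (simp add: field_simps power2_eq_square)
  ultimately show ?thesis by simp
qed

text \<open>Twice the integral of the interpolation over the first \<open>m\<close> cells.\<close>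

definition trapezoid :: "int list \<Rightarrow> nat \<Rightarrow> int" where
  "trapezoid t m = (\<Sum>k\<leftarrow>[0..<m]. node t k + node t (Suc k))"

lemma interp_has_integral:
  assumes P: "0 < P" and r: "0 \<le> r" "r \<le> 1"
  shows "((\<lambda>z. interp t (P * z)) has_integral
     (real_of_int (trapezoid t m) / 2 + r * real_of_int (node t m)
        + r\<^sup>2 / 2 * (real_of_int (node t (Suc m)) - real_of_int (node t m))) / P)
     {0..(real m + r) / P}"
proof -
  have *: "((\<lambda>z. interp t (P * z)) has_integral (real_of_int (trapezoid t m) / 2) / P) {0..real m / P}"
  proof (induction m)
    case 0
    then show ?case by (simp add: trapezoid_def has_integral_refl)
  next
    case (Suc m)
    have "((\<lambda>z. interp t (P * z)) has_integral (real_of_int (trapezoid t m) / 2) / P +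
       (real_of_int (node t m) + 1 / 2 * (real_of_int (node t (Suc m)) - real_of_int (node t m))) / P) {0..real (Suc m) / P}"
      using P interp_cell_has_integral[OF P, of 1 t m]
      by (intro has_integral_combine[OF _ _ Suc.IH]) (auto simp: divide_right_mono add.commute)
    moreover have "(real_of_int (trapezoid t m) / 2) / P +
       (real_of_int (node t m) + 1 / 2 * (real_of_int (node t (Suc m)) - real_of_int (node t m))) / P
       = (real_of_int (trapezoid t (Suc m)) / 2) / P"
      using P by (simp add: trapezoid_def field_simps)
    ultimately show ?case by simp
  qed
  have "((\<lambda>z. interp t (P * z)) has_integral (real_of_int (trapezoid t m) / 2) / P
     + (r * real_of_int (node t m) + r\<^sup>2 / 2 * (real_of_int (node t (Suc m)) - real_of_int (node t m))) / P)
     {0..(real m + r) / P}"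
    using P r interp_cell_has_integral[OF P r, of t m]
    by (intro has_integral_combine[OF _ _ *]) (auto simp: divide_right_mono)
  then show ?thesis by (simp add: add_divide_distrib add.assoc)
qed

section \<open>Tabulated weights\<close>

text \<open>The tables list, in units of \<open>1 / 1587\<close>, the values of the three weights at multiples of \<open>1 / 22\<close>
  (columns and rows) and \<open>1 / 44\<close> (diagonals). With these mesh widths a queen at integral multiples of
  \<open>1 / 22\<close> has both of its diagonals at nodes. The values are a rounded solution of the dual linear
  program that is discretised on this grid. They roughly follow pieces of parabolas: \<open>line_table\<close> is convex
  up to node 6 and concave beyond, \<open>major_table\<close> has a concave cap between two convex arcs, and
  \<open>minor_table\<close> is nearly concave.\<close>

definition line_table :: "int list" where
  "line_table = [0, 12, 24, 61, 98, 159, 220, 260, 295, 325, 350, 370, 385, 395, 400, 400,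
    395, 385, 370, 350, 325, 295, 260]"

definition major_table :: "int list" where
  "major_table = [294, 294, 299, 304, 314, 324, 339, 354, 374, 394, 419, 444, 474, 504, 539, 574, 587,
    601, 602, 604, 593, 573, 553, 538, 523, 513, 503, 498, 493, 493, 493, 498, 503, 513, 523, 538]"

definition minor_table :: "int list" where
  "minor_table = [787, 787, 775, 763, 738, 714, 677, 641, 592, 543, 482]"

text \<open>The bounds at corners and centres of the cells for one queen with both parities right; by symmetry
  only the quadrant with nonnegative coordinates is inspected. The number \<open>(i - j) + (j - i)\<close> is the
  distance of \<open>i\<close> and \<open>j\<close>, the subtraction of natural numbers being truncated.\<close>

definition vertex_check :: "int list \<Rightarrow> int list \<Rightarrow> bool" where
  "vertex_check t u \<longleftrightarrow> (\<forall>i\<in>set [0..<23]. \<forall>j\<in>set [0..<23].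
     node t i + node t j + node u ((i - j) + (j - i)) + node u (i + j) \<le> 1587 \<and>
     node t i + node t (Suc i) + node t j + node t (Suc j)
       + 2 * node u ((i - j) + (j - i)) + 2 * node u (Suc (i + j)) \<le> 2 * 1587)"

lemma vertex_check_tables: "vertex_check line_table major_table" "vertex_check line_table minor_table"
  by code_simp+

lemma trapezoid_tables: "trapezoid line_table 22 = 12008" "trapezoid major_table 34 = 32079" "trapezoid minor_table 9 = 12704"
  by code_simp+

lemma node_tables: "node major_table 34 = 523" "node major_table 35 = 538" "node minor_table 9 = 543" "node minor_table 10 = 482"
  by code_simp+

lemma steps_tables: "\<forall>k\<in>set [0..<22]. \<bar>node line_table (Suc k) - node line_table k\<bar> \<le> 72"
  "\<forall>k\<in>set [0..<35]. \<bar>node major_table (Suc k) - node major_table k\<bar> \<le> 72"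
  "\<forall>k\<in>set [0..<10]. \<bar>node minor_table (Suc k) - node minor_table k\<bar> \<le> 72"
  by code_simp+

lemma range_tables: "\<forall>x\<in>set line_table. 0 \<le> x \<and> x \<le> 400" "\<forall>x\<in>set major_table. 0 \<le> x \<and> x \<le> 604"
  "\<forall>x\<in>set minor_table. 0 \<le> x \<and> x \<le> 787"
  by code_simp+


lemma node_between:
  assumes "\<forall>x\<in>set t. 0 \<le> x \<and> x \<le> c" "0 \<le> c"
  shows "0 \<le> node t k" "node t k \<le> c"
  using assms by (simp_all add: node_def)

text \<open>The Lipschitz constant is \<open>72 * 44 / 1587 < 2\<close>.\<close>

lemma interp_scaled_lipschitz:
  assumes steps: "\<forall>k\<in>set [0..<m]. \<bar>node t (Suc k) - node t k\<bar> \<le> 72" and P: "0 < P" "P \<le> 44"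
    and R: "R = real m / P"
  shows "2-lipschitz_on {0..R} (\<lambda>z. interp t (P * z) / 1587)"
proof (rule lipschitz_onI)
  fix z w assume zw: "z \<in> {0..R}" "w \<in> {0..R}"
  have dom: "P * z \<in> {0..real m}" "P * w \<in> {0..real m}"
    using zw P unfolding R by (auto simp: field_simps)
  have "(real_of_int 72)-lipschitz_on {0..real m} (interp t)"
    by (rule interp_lipschitz) (use steps in auto)
  from lipschitz_onD[OF this dom]
  have "\<bar>interp t (P * z) - interp t (P * w)\<bar> \<le> 72 * \<bar>P * z - P * w\<bar>"
    by (simp add: dist_real_def)
  also have "\<bar>P * z - P * w\<bar> = P * \<bar>z - w\<bar>"
    using P by (simp add: abs_mult right_diff_distrib[symmetric])
  also have "P * \<bar>z - w\<bar> \<le> 44 * \<bar>z - w\<bar>" using P by (intro mult_right_mono) auto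
  finally have "\<bar>interp t (P * z) - interp t (P * w)\<bar> \<le> 72 * (44 * \<bar>z - w\<bar>)" by simp
  then have "\<bar>interp t (P * z) - interp t (P * w)\<bar> / 1587 \<le> 2 * \<bar>z - w\<bar>" by simp
  then show "dist (interp t (P * z) / 1587) (interp t (P * w) / 1587) \<le> 2 * dist z w"
    by (simp add: dist_real_def diff_divide_distrib[symmetric] abs_divide)
qed simp

lemma interp_queen_le:
  fixes x y :: real
  assumes check: "vertex_check t u" and xy: "\<bar>x\<bar> < 1" "\<bar>y\<bar> < 1"
  shows "interp t (22 * \<bar>x\<bar>) / 1587 + interp t (22 * \<bar>y\<bar>) / 1587
    + interp u (44 * \<bar>(y - x) / 2\<bar>) / 1587 + interp u (44 * \<bar>(x + y) / 2\<bar>) / 1587 \<le> 1"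
proof -
  let ?h = "\<lambda>x. interp t \<bar>x\<bar>" and ?f = "\<lambda>x. interp u \<bar>x\<bar>"
  define X Y where "X = 22 * \<bar>x\<bar>" and "Y = 22 * \<bar>y\<bar>"
  have node: "interp v \<bar>real_of_int k\<bar> = real_of_int (node v (nat \<bar>k\<bar>))" for v k
    using interp_nat[of v "nat \<bar>k\<bar>"] by simp
  have vertices: "node t i + node t j + node u ((i - j) + (j - i)) + node u (i + j) \<le> 1587"
    "node t i + node t (Suc i) + node t j + node t (Suc j)
       + 2 * node u ((i - j) + (j - i)) + 2 * node u (Suc (i + j)) \<le> 2 * 1587"
    if "i \<le> 22" "j \<le> 22" for i j
    using check that unfolding vertex_check_def by auto
  have "?h X + ?h Y + ?f (Y - X) + ?f (X + Y) \<le> 1587"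
  proof (rule cellwise_affine_le[where m = 22])
    fix i j :: int
    assume ij: "0 \<le> i" "i \<le> 22" "0 \<le> j" "j \<le> 22"
    define a b where "a = nat i" and "b = nat j"
    have ab: "i = int a" "j = int b" "a \<le> 22" "b \<le> 22" using ij by (auto simp: a_def b_def)
    have ix: "nat \<bar>j - i\<bar> = (a - b) + (b - a)" "nat \<bar>i + j\<bar> = a + b" "nat \<bar>i\<bar> = a" "nat \<bar>j\<bar> = b"
      using ab by auto
    show "?h (real_of_int i) + ?h (real_of_int j) + ?f (real_of_int (j - i)) + ?f (real_of_int (i + j)) \<le> 1587"
      unfolding node ix using vertices(1)[OF ab(3,4)] by linarith
  next
    fix i j :: int
    assume ij: "0 \<le> i" "i < 22" "0 \<le> j" "j < 22"
    define a b where "a = nat i" and "b = nat j"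
    have ab: "i = int a" "j = int b" "a \<le> 22" "b \<le> 22" using ij by (auto simp: a_def b_def)
    have ix: "nat \<bar>j - i\<bar> = (a - b) + (b - a)" "nat \<bar>i + j + 1\<bar> = Suc (a + b)"
      "nat \<bar>i\<bar> = a" "nat \<bar>j\<bar> = b" "nat \<bar>i + 1\<bar> = Suc a" "nat \<bar>j + 1\<bar> = Suc b"
      using ab by auto
    show "?h (real_of_int i) + ?h (real_of_int (i + 1)) + ?h (real_of_int j) + ?h (real_of_int (j + 1))
        + 2 * ?f (real_of_int (j - i)) + 2 * ?f (real_of_int (i + j + 1)) \<le> 2 * 1587"
      unfolding node ix using vertices(2)[OF ab(3,4)] by linarith
  qed (use xy in \<open>auto simp: X_def Y_def cellwise_affine_interp_abs\<close>)
  moreover have "?f (Y - X) + ?f (X + Y) = interp u (44 * \<bar>(y - x) / 2\<bar>) + interp u (44 * \<bar>(x + y) / 2\<bar>)"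
  proof (cases "0 \<le> x * y")
    case True
    then have "\<bar>Y - X\<bar> = 44 * \<bar>(y - x) / 2\<bar>" "\<bar>X + Y\<bar> = 44 * \<bar>(x + y) / 2\<bar>"
      unfolding X_def Y_def by (auto simp: zero_le_mult_iff abs_if field_simps)
    then show ?thesis by simp
  next
    case False
    then have "\<bar>Y - X\<bar> = 44 * \<bar>(x + y) / 2\<bar>" "\<bar>X + Y\<bar> = 44 * \<bar>(y - x) / 2\<bar>"
      unfolding X_def Y_def by (auto simp: not_le mult_less_0_iff abs_if field_simps)
    then show ?thesis by simp
  qed
  ultimately show ?thesis by (simp add: X_def Y_def add_divide_distrib[symmetric])
qed

lemma table_weights:
  "weight_system (\<lambda>z. interp line_table (22 * z) / 1587) (\<lambda>z. interp major_table (44 * z) / 1587)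
     (\<lambda>z. interp minor_table (44 * z) / 1587) (35 / 44) (10 / 44)"
proof
  have b: "0 \<le> interp line_table x" "interp line_table x \<le> 400" "0 \<le> interp major_table x" "interp major_table x \<le> 604"
    "0 \<le> interp minor_table x" "interp minor_table x \<le> 787" if "0 \<le> x" for x
    using interp_bounds[OF that node_between[OF range_tables(1)]]
      interp_bounds[OF that node_between[OF range_tables(2)]]
      interp_bounds[OF that node_between[OF range_tables(3)]] by simp_all
  show "0 \<le> interp line_table (22 * z) / 1587 \<and> interp line_table (22 * z) / 1587 \<le> 1 \<and>
      0 \<le> interp major_table (44 * z) / 1587 \<and> interp major_table (44 * z) / 1587 \<le> 1 \<and>
      0 \<le> interp minor_table (44 * z) / 1587 \<and> interp minor_table (44 * z) / 1587 \<le> 1"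
    if "z \<in> {0..1}" for z :: real
    using b[of "22 * z"] b[of "44 * z"] that by simp
  show "interp major_table (44 * \<bar>(y - x) / 2\<bar>) / 1587 + interp minor_table (44 * \<bar>(x + y) / 2\<bar>) / 1587 \<le> 1"
    for x y :: real
    using b(4)[of "44 * \<bar>(y - x) / 2\<bar>"] b(6)[of "44 * \<bar>(x + y) / 2\<bar>"] by simp
  show "2-lipschitz_on {0..1} (\<lambda>z. interp line_table (22 * z) / 1587)"
    by (rule interp_scaled_lipschitz[OF steps_tables(1)]) simp_all
  show "2-lipschitz_on {0..35 / 44} (\<lambda>z. interp major_table (44 * z) / 1587)"
    by (rule interp_scaled_lipschitz[OF steps_tables(2)]) simp_all
  show "2-lipschitz_on {0..10 / 44} (\<lambda>z. interp minor_table (44 * z) / 1587)"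
    by (rule interp_scaled_lipschitz[OF steps_tables(3)]) simp_all
qed (rule interp_queen_le; simp add: vertex_check_tables)+

lemma table_line_integral: "integral {0..1} (\<lambda>z. interp line_table (22 * z) / 1587) = 6004 / (22 * 1587)"
  using interp_has_integral[of 22 0 line_table 22] by (simp add: trapezoid_tables integral_unique)

text \<open>For \<open>t\<close> in this range, \<open>t\<close> and \<open>1 - t\<close> each stay within one cell of their tables, so the sum of
  the two integrals is a quadratic polynomial in \<open>t\<close>. It is concave, hence smallest at an end of the range.\<close>

lemma table_diagonal_integrals_ge:
  fixes t :: real
  assumes t: "69 / 88 \<le> t" "t \<le> 35 / 44"
  shows "458370 / (20 * 44 * 1587) \<le> integral {0..t} (\<lambda>z. interp major_table (44 * z) / 1587)
    + integral {0..1 - t} (\<lambda>z. interp minor_table (44 * z) / 1587)"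
proof -
  define r where "r = 44 * t - 34"
  have r: "1 / 2 \<le> r" "r \<le> 1" using t by (simp_all add: r_def)
  have ends: "t = (real 34 + r) / 44" "1 - t = (real 9 + (1 - r)) / 44" by (simp_all add: r_def field_simps)
  define A B where "A = 32079 / 2 + r * 523 + r\<^sup>2 / 2 * 15"
    and "B = 12704 / 2 + (1 - r) * 543 + (1 - r)\<^sup>2 / 2 * (- 61)"
  have f: "integral {0..t} (\<lambda>z. interp major_table (44 * z)) = A / 44"
    using interp_has_integral[of 44 r major_table 34] r unfolding ends(1)
    by (simp add: trapezoid_tables node_tables integral_unique A_def)
  have f': "integral {0..1 - t} (\<lambda>z. interp minor_table (44 * z)) = B / 44"
    using interp_has_integral[of 44 "1 - r" minor_table 9] r unfolding ends(2)
    by (simp add: trapezoid_tables node_tables integral_unique B_def)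
  have sq: "(1 - r)\<^sup>2 = 1 - 2 * r + r\<^sup>2" by (simp add: power2_diff)
  have "0 \<le> (r - 1 / 2) * (1 - r)" using r by simp
  then have "r\<^sup>2 \<le> 3 / 2 * r - 1 / 2" by (simp add: power2_eq_square field_simps)
  moreover have "A + B = 22904 + 41 * r - 23 * r\<^sup>2"
    unfolding A_def B_def sq by (simp add: field_simps)
  ultimately have "458370 / 20 \<le> A + B"
    using r by linarith
  then show ?thesis by (simp add: f f')
qed

section \<open>The lower bound\<close>

text \<open>This counts the required diagonals, which is the weight estimate with constant weight 1 on one
  direction of diagonals at a time. Together with a bound on \<open>card C\<close> it puts \<open>e + e'\<close> near \<open>n\<close>.\<close>

lemma (in parity_cover) radii_balanced:
  fixes e e' :: nat
  assumes r: "occupied_radius \<delta> e" and r': "occupied_radius (\<delta> + 2) e'"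
  shows "real e + real e' \<le> 2 * real (card C) + 26"
    "2 * real n - real e - real e' \<le> 2 * real (card C) + 26 + 4 * real extra"
proof -
  have e: "e \<le> n" "residue_window \<delta> (int e - 1) \<subseteq> diff_no ` C"
      "card {s \<in> residue_window (opposite \<delta>) (int n - 1 - int e). s \<notin> sum_no n ` C} \<le> extra"
    and e': "e' \<le> n" "residue_window (\<delta> + 2) (int e' - 1) \<subseteq> diff_no ` C"
      "card {s \<in> residue_window (opposite (\<delta> + 2)) (int n - 1 - int e'). s \<notin> sum_no n ` C} \<le> extra"
    using r r' by (simp_all add: occupied_radius_def)
  have lines: "\<bar>diff_no u\<bar> \<le> int n - 1" "\<bar>sum_no n u\<bar> \<le> int n - 1" if "u \<in> C" for u
    using board_lines_bounded[of u n] C_board that by auto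
  have count: "real N / 2 - 13 / 2 - real m \<le> (\<Sum>u\<in>C. class_weight (\<lambda>_. 1) c (\<phi> u))"
    if "N \<le> n" "\<And>u. u \<in> C \<Longrightarrow> \<bar>\<phi> u\<bar> \<le> int n - 1"
      "card {k \<in> residue_window c (int N - 1). k \<notin> \<phi> ` C} \<le> m" for N m c \<phi>
  proof -
    have "real n / 2 * integral {0..real N / real n} (\<lambda>_. 1::real) - 13 / 2 - real m
        \<le> (\<Sum>u\<in>C. class_weight (\<lambda>_. 1) c (\<phi> u))"
      by (rule weight_of_window_le[where a = "int N - 1"])
        (use n_pos that in \<open>auto intro: lipschitz_intros lipschitz_on_le simp: lipschitz_on_def\<close>)
    then show ?thesis using n_pos by simp
  qed
  have sub: "int (n - e) - 1 = int n - 1 - int e" "int (n - e') - 1 = int n - 1 - int e'"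
    using e(1) e'(1) by auto
  have one: "(\<Sum>u\<in>C. class_weight (\<lambda>_. 1) c (\<phi> u)) + (\<Sum>u\<in>C. class_weight (\<lambda>_. 1) c' (\<phi> u)) \<le> real (card C)"
    if "c mod 4 \<noteq> c' mod 4" for c c' :: int and \<phi>
  proof -
    have "(\<Sum>u\<in>C. class_weight (\<lambda>_. 1) c (\<phi> u) + class_weight (\<lambda>_. 1) c' (\<phi> u)) \<le> real (card C) * 1"
      using that by (intro sum_bounded_above) (auto simp: class_weight_def)
    then show ?thesis by (simp add: sum.distrib)
  qed
  have ne: "\<delta> mod 4 \<noteq> (\<delta> + 2) mod 4" "opposite \<delta> mod 4 \<noteq> opposite (\<delta> + 2) mod 4"
    by (simp_all add: mod_eq_dvd_iff opposite_def)
  show "real e + real e' \<le> 2 * real (card C) + 26"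
    using count[OF e(1) lines(1) no_missing[OF e(2)]] count[OF e'(1) lines(1) no_missing[OF e'(2)]] one[OF ne(1), of diff_no]
    by simp
  have "real (n - e) / 2 - 13 / 2 - real extra \<le> (\<Sum>u\<in>C. class_weight (\<lambda>_. 1) (opposite \<delta>) (sum_no n u))"
    "real (n - e') / 2 - 13 / 2 - real extra \<le> (\<Sum>u\<in>C. class_weight (\<lambda>_. 1) (opposite (\<delta> + 2)) (sum_no n u))"
    using lines(2) e(3) e'(3) unfolding sub[symmetric] by (intro count; simp)+
  then show "2 * real n - real e - real e' \<le> 2 * real (card C) + 26 + 4 * real extra"
    using one[OF ne(2), of "sum_no n"] e(1) e'(1) by (simp add: of_nat_diff diff_divide_distrib)
qed

text \<open>If \<open>t = t'\<close> and the products added up to \<open>1 / 3\<close>, then \<open>t\<close> would be \<open>(3 + sqrt 3) / 6\<close>, about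
  \<open>0.7887\<close>. The interval from \<open>69 / 88\<close> to \<open>35 / 44\<close>, roughly \<open>0.784\<close> to \<open>0.795\<close>, leaves room for the
  tolerances. The condition \<open>1 \<le> t + t'\<close> excludes the other root.\<close>

lemma range_from_product:
  fixes t t' :: real
  assumes "1 \<le> t + t'" "\<bar>t - t'\<bar> \<le> 1 / 1000"
    and q: "1 / 3 - 3 / 10000 \<le> t * (1 - t) + t' * (1 - t')" "t * (1 - t) + t' * (1 - t') \<le> 1 / 3 + 6 / 10000"
  shows "69 / 88 \<le> t" "t \<le> 35 / 44"
proof -
  have t: "4995 / 10000 \<le> t" "4995 / 10000 \<le> t'" using assms(1,2) by linarith+
  show "69 / 88 \<le> t"
  proof (rule ccontr)
    assume "\<not> 69 / 88 \<le> t"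
    then have u: "t \<le> 69 / 88" "t' \<le> 786 / 1000" using assms(2) by linarith+
    have "0 \<le> (t - 4995 / 10000) * (69 / 88 - t)" "0 \<le> (t' - 4995 / 10000) * (786 / 1000 - t')"
      using t u by simp_all
    then show False using q t u by (simp add: field_simps)
  qed
  show "t \<le> 35 / 44"
  proof (rule ccontr)
    assume "\<not> t \<le> 35 / 44"
    then have u: "35 / 44 \<le> t" "794 / 1000 \<le> t'" using assms(2) by linarith+
    have "0 \<le> (t - 35 / 44) * (t - 9 / 44)" "0 \<le> (t' - 794 / 1000) * (t' - 206 / 1000)"
      using u by simp_all
    then show False using q u by (simp add: field_simps)
  qed
qed

text \<open>If the claim fails, no weight system that is Lipschitz as far as \<open>t\<close>, \<open>t'\<close>, \<open>1 - t\<close> and \<open>1 - t'\<close> has a total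
  above \<open>1 + 3 / 10000\<close>. The two quadratic systems then confine \<open>t\<close> and \<open>t'\<close> to the range in which the tabulated system has a larger total.\<close>

lemma (in parity_cover) card_gt_of_radii:
  fixes e e' :: nat
  assumes n: "400001 \<le> n" and \<delta>: "\<delta> mod 2 = (q - p) mod 2" and le: "e' \<le> e"
    and r: "occupied_radius \<delta> e" and r': "occupied_radius (\<delta> + 2) e'"
  shows "real (card C) > 40001 / 80000 * real n - 2"
proof (rule ccontr)
  assume "\<not> ?thesis"
  then have m: "real (card C) \<le> 40001 / 80000 * real n - 2" by simp
  have N: "400001 \<le> real n" using n by simp
  define t t' where "t = real e / real n" and "t' = 1 - real e' / real n"
  have tn: "real n * t = real e" "real n * t' = real n - real e'"
    using n_pos by (simp_all add: t_def t'_def right_diff_distrib)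
  have "e \<le> n" "e' \<le> n" using r r' by (simp_all add: occupied_radius_def)
  then have t01: "0 \<le> t" "t \<le> 1" "0 \<le> t'" "t' \<le> 1"
    using n_pos by (simp_all add: t_def t'_def)
  have \<Phi>_le: "2 * integral {0..1} h + (integral {0..t} f + integral {0..1 - t} f')
     + (integral {0..t'} f + integral {0..1 - t'} f') \<le> 1 + 3 / 10000" (is "?\<Phi> \<le> _")
    if "weight_system h f f' R R'" "t \<le> R" "t' \<le> R" "1 - t \<le> R'" "1 - t' \<le> R'" for h f f' R R'
  proof -
    \<comment> \<open>The right-hand side bounds \<open>card C + 39 + 2 * extra\<close>, with \<open>extra \<le> 2 * card C - n + 1\<close>.\<close>
    have "real n / 2 * ?\<Phi> \<le> real n / 2 * (1 + 1 / 8000) + 31"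
      using card_ge_weight_integrals[OF that(1) \<delta> r r' t_def t'_def that(2-5)] extra_le m by simp
    also have "\<dots> \<le> real n / 2 * (1 + 3 / 10000)" using N by simp
    finally show ?thesis using n_pos by simp
  qed
  have "real n * (t - t') \<le> real n * (1 / 1000)" "real n * (t' - t) \<le> real n * (1 / 1000)"
    unfolding right_diff_distrib tn using radii_balanced[OF r r'] extra_le m N by linarith+
  then have "t - t' \<le> 1 / 1000" "t' - t \<le> 1 / 1000" using n_pos by simp_all
  then have close: "\<bar>t - t'\<bar> \<le> 1 / 1000" "\<bar>t' - t\<bar> \<le> 1 / 1000" by linarith+
  have "real n * 1 \<le> real n * (t + t')" using le tn by (simp add: distrib_left)
  then have sum: "1 \<le> t + t'" "1 \<le> t' + t" using n_pos by simp_all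
  define a a' where "a = t * (1 - t)" and "a' = t' * (1 - t')"
  have cube: "x ^ 3 + (1 - x) ^ 3 = 1 - 3 * (x * (1 - x))" for x :: real
    by (simp add: power3_eq_cube algebra_simps)
  note cubes = cube[of t, folded a_def] cube[of t', folded a'_def]
  have nonneg: "0 \<le> 1 - t" "0 \<le> 1 - t'" "0 \<le> (1::real)" "1 - t \<le> 1" "1 - t' \<le> 1"
    using t01 by simp_all
  have third: "1 / 2 - 1 / 6 = (1 / 3 :: real)" by simp
  note integrals = integral_square integral_half_minus_square integral_quarter_square
  have "1 / 3 - 3 / 10000 \<le> a + a'"
    using \<Phi>_le[OF outer_weights t01(2,4) nonneg(4,5)] cubes t01 nonneg(1-3)
    by (simp only: integrals diff_divide_distrib power_one third)
  moreover have "a + a' \<le> 1 / 3 + 6 / 10000"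
    using \<Phi>_le[OF inner_weights t01(2,4) nonneg(4,5)] cubes t01 nonneg(1-3)
    by (simp only: integrals diff_divide_distrib power_one third)
  ultimately have q: "1 / 3 - 3 / 10000 \<le> t * (1 - t) + t' * (1 - t')"
      "t * (1 - t) + t' * (1 - t') \<le> 1 / 3 + 6 / 10000"
    and q': "1 / 3 - 3 / 10000 \<le> t' * (1 - t') + t * (1 - t)"
      "t' * (1 - t') + t * (1 - t) \<le> 1 / 3 + 6 / 10000"
    by (simp_all add: a_def a'_def add.commute)
  note range = range_from_product[OF sum(1) close(1) q] range_from_product[OF sum(2) close(2) q']
  show False
    using \<Phi>_le[OF table_weights] table_line_integral table_diagonal_integrals_ge[OF range(1,2)]
      table_diagonal_integrals_ge[OF range(3,4)] range by simp
qed

theorem theorem2p3: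
  fixes n :: nat and C :: "square set" and c1 :: real
  defines "c1 \<equiv> 40001 / 80000"
  assumes "n \<ge> 400001" and "orthodox_cover n C"
  shows "real (card C) > c1 * real n - 2"
proof -
  obtain p q where p: "p \<in> {0, 1}" and q: "q \<in> {0, 1}"
    and lines: "\<forall>x\<in>{0..<int n}. x mod 2 = p \<longrightarrow> column_occupied C x"
      "\<forall>y\<in>{0..<int n}. y mod 2 = q \<longrightarrow> row_occupied C y"
    using assms(3) unfolding orthodox_cover_def by blast
  have "dominating_set (queens_graph n) C" using assms(3) by (simp add: orthodox_cover_def)
  then have "parity_cover n C p q" using p q lines assms(2) by unfold_locales auto
  then interpret parity_cover n C p q .
  define \<delta> where "\<delta> = q - p"
  have \<delta>: "\<delta> mod 2 = (q - p) mod 2" "(\<delta> + 2) mod 2 = (q - p) mod 2" by (simp_all add: \<delta>_def)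
  obtain e e' where e: "occupied_radius \<delta> e" and e': "occupied_radius (\<delta> + 2) e'"
    using ex_occupied_radius \<delta> by blast
  \<comment> \<open>Adding 2 twice to \<open>\<delta>\<close> returns to the same class, so the two radii may be exchanged.\<close>
  have shift: "residue_window (c + 4) = residue_window c" for c
    by (simp add: residue_window_def fun_eq_iff)
  have "\<delta> + 2 + 2 = \<delta> + 4" "opposite (\<delta> + 2 + 2) = opposite \<delta> + 4"
    by (simp_all add: opposite_def)
  then have cycle: "occupied_radius (\<delta> + 2 + 2) e"
    using e unfolding occupied_radius_def by (simp only: shift)
  show ?thesis
  proof (cases "e' \<le> e")
    case True
    then show ?thesis unfolding c1_def by (rule card_gt_of_radii[OF assms(2) \<delta>(1) _ e e'])
  next
    case False
    then have "e \<le> e'" by simp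
    then show ?thesis unfolding c1_def
      by (rule card_gt_of_radii[OF assms(2) \<delta>(2) _ e' cycle])
  qed
qed

end
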